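(* Let $H=(B,A,\blacktriangleright,\partial)$ be a crossed module, viewed as a group object in $\mathrm{Cat}$, and $\Sigma$ an oriented closed surface of genus $g\ge1$. Then the $\mathrm{Map}(\Sigma)$-action on the protected object $\mathcal M_{inv}$ of $H$ and $\Sigma$ induced by edge slides is induced by the $\mathrm{Map}(\Sigma)$-action on the representation variety $\mathrm{Hom}(\pi_1(\Sigma),A\rtimes B)/A\rtimes B$; that is, $\varphi\in\mathrm{Map}(\Sigma)$ acts on the morphism of $\mathcal M_{inv}$ represented by a group homomorphism $\tau:\pi_1(\Sigma)\to A\rtimes B$ by sending it to the morphism represented by any representative of $\varphi\triangleright[\tau]$.
   Context: Crossed modules. A crossed module $(B,A,\blacktriangleright,\partial)$ consists of groups $A,B$, a group homomorphism $\partial:A\to B$ and an action $\blacktriangleright:B\times A\to A$ by group automorphisms with $\partial(b\blacktriangleright a)=b\partial(a)b^{-1}$ and $\partial(a)\blacktriangleright a'=aa'a^{-1}$. $A\rtimes B$ has multiplication $(a',b')(a,b)=(a'(b'\blacktriangleright a),b'b)$. The associated group object $H$ in $(\mathrm{Cat},\times)$ has $\mathrm{Ob}\,H=B$, $\mathrm{Hom}_H(b,b')=\{(a,b)\in A\times B\mid\partial(a)b=b'\}$, composition $(a',\partial(a)b)\circ(a,b)=(a'a,b)$, group structure on objects that of $B$ and on morphisms that of $A\rtimes B$. Protected object. $\pi_1(\Sigma)=\langle\alpha_1,\beta_1,\dots,\alpha_g,\beta_g\mid[\beta_g^{-1},\alpha_g]\cdots[\beta_1^{-1},\alpha_1]=1\rangle$,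 $[x,y]=xyx^{-1}y^{-1}$. Let $\mathcal M=H^{\times2g}$ with the conjugation functor $\triangleright:H\times\mathcal M\to\mathcal M$, $h\triangleright(a_1,b_1,\dots,a_g,b_g)=(ha_1h^{-1},\dots,hb_gh^{-1})$ and $F:\mathcal M\to H$, $F(a_1,\dots,b_g)=[b_g^{-1},a_g]\cdots[b_1^{-1},a_1]$. $\iota:\mathcal M^{coH}\to\mathcal M$ is the equaliser in $\mathrm{Cat}$ of $x\mapsto(F(x),x)$ and $x\mapsto(e,x)$ (with $e$ the unit of $H$), i.e. the subcategory on which $F$ is trivial, $\pi:\mathcal M\to\mathcal M^H$ the coequaliser in $\mathrm{Cat}$ of $\triangleright$ and the projection $H\times\mathcal M\to\mathcal M$, and the protected object $\mathcal M_{inv}$ is the image of $\pi\circ\iota$ (the smallest subobject of $\mathcal M^H$ through which $\pi\circ\iota$ factorises). The functor $P:\mathcal M^{coH}\to\mathcal M_{inv}$ is surjective on objects and morphisms. Objects of $\mathcal M^{coH}$ are identified with group homomorphisms $\rho:\pi_1(\Sigma)\to B$ and morphisms with group homomorphisms $\tau:\pi_1(\Sigma)\to A\rtimes B$; the morphism of $\mathcal M_{inv}$ represented by $\tau$ is $P(\tau)$, and it depends only on the conjugacy class $[\tau]$. Mapping class group. $\mathrm{Map}(\Sigma)$ is the group of orientation preserving homeomorphisms of $\Sigma$ modulo those homotopic to the identity, acting on $\pi_1(\Sigma)$ by outer automorphisms. For a group $G$ it acts on $\mathrm{Hom}(\pi_1(\Sigma),G)/G$ by $\varphi\triangleright[\tau]=[\tau\circ\tilde\varphi^{-1}]$,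 with $\tilde\varphi\in\mathrm{Aut}(\pi_1(\Sigma))$ representing $\varphi$. Action by edge slides. The standard graph of $\Sigma$ has a single vertex $v$, edges $\alpha_1,\beta_1,\dots,\alpha_g,\beta_g$ and ordering of edge ends at $v$ (counterclockwise) $s(\alpha_1)<s(\beta_1)<t(\alpha_1)<t(\beta_1)<\dots<s(\alpha_g)<s(\beta_g)<t(\alpha_g)<t(\beta_g)$; its complement in $\Sigma$ is a disc. Remove an open disc $D$ in this face and represent the linear ordering by an arc (cilium) from $v$ to $\partial D$. If the starting end of an edge $\alpha$ comes directly before the target end of an edge $\beta\neq\alpha$, sliding the target end of $\beta$ along $\alpha$ moves it to $t(\alpha)$, directly before the target end of $\alpha$; the associated automorphism of $H^{\times2g}$ (factors labelled by edges) replaces $(\alpha,\beta)$ by $(\alpha,\alpha\beta)$. Other slides arise from these and their inverses by reversing edge orientations before and after the slide (inverting the corresponding factor). Only slides not moving edge ends over the cilium are considered. If after a finite sequence of slides the resulting embedded graph, with edges labelled by those of the standard graph, has the same linear ordering of edge ends, there is a unique mapping class $f$ of $\Sigma\setminus D$ (fixing $\partial D$) mapping the standard graph to it edge by edge; the sequence realises $f^{-1}$. The composite of the associated automorphisms of $H^{\times 2g}$ respects $\triangleright$ and $F$ and hence induces an automorphism of $\mathcal M_{inv}$. The action of $\mathrm{Map}(\Sigma)$ on $\mathcal M_{inv}$ induced by edge slides assigns to the image in $\mathrm{Map}(\Sigma)$ of a mapping class $\varphi$ of $\Sigma\setminus D$ the automorphism induced by a finite sequence of edge slides realising $\varphi$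.
   Formalization: The standard graph is taken with edge ends ordered t(α_i)<t(β_i)<s(α_i)<s(β_i) instead of s(α_i)<s(β_i)<t(α_i)<t(β_i), since with the stated order and slide rule (α,β)→(α,αβ) slides need not preserve F=1 for g≥2, so no action on M_inv would be induced. *)

theory Defs
  imports "HOL-Homology.Homology" "HOL-Algebra.Coset"
begin

section \<open>Small categories\<close>

text \<open>\<open>Comp C n m\<close> is the composite of \<open>m\<close> followed by \<open>n\<close>.  Functors are pairs consisting of an
  object map and an arrow map.\<close>

record ('o, 'm) small_category =
  Obj :: "'o set"
  Arr :: "'m set"
  Dom :: "'m \<Rightarrow> 'o"
  Cod :: "'m \<Rightarrow> 'o"
  Ident :: "'o \<Rightarrow> 'm"
  Comp :: "'m \<Rightarrow> 'm \<Rightarrow> 'm"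

type_synonym ('o, 'm, 'p, 'n) functor_maps = "('o \<Rightarrow> 'p) \<times> ('m \<Rightarrow> 'n)"

definition is_functor ::
  "('o, 'm) small_category \<Rightarrow> ('p, 'n) small_category \<Rightarrow> ('o, 'm, 'p, 'n) functor_maps \<Rightarrow> bool" where
  "is_functor C D F \<longleftrightarrow>
     (\<forall>x\<in>Obj C. fst F x \<in> Obj D \<and> snd F (Ident C x) = Ident D (fst F x)) \<and>
     (\<forall>m\<in>Arr C. snd F m \<in> Arr D
        \<and> Dom D (snd F m) = fst F (Dom C m) \<and> Cod D (snd F m) = fst F (Cod C m)) \<and>
     (\<forall>m\<in>Arr C. \<forall>n\<in>Arr C. Cod C m = Dom C n \<longrightarrow>
        snd F (Comp C n m) = Comp D (snd F n) (snd F m))"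

definition category_automorphism ::
  "('o, 'm) small_category \<Rightarrow> ('o, 'm, 'o, 'm) functor_maps \<Rightarrow> bool" where
  "category_automorphism C F \<longleftrightarrow>
     is_functor C C F \<and> bij_betw (fst F) (Obj C) (Obj C) \<and> bij_betw (snd F) (Arr C) (Arr C)"

definition cat_prod ::
  "('o, 'm) small_category \<Rightarrow> ('p, 'n) small_category \<Rightarrow> ('o \<times> 'p, 'm \<times> 'n) small_category" where
  "cat_prod C D =
     \<lparr>Obj = Obj C \<times> Obj D, Arr = Arr C \<times> Arr D,
      Dom = map_prod (Dom C) (Dom D), Cod = map_prod (Cod C) (Cod D),
      Ident = map_prod (Ident C) (Ident D),
      Comp = (\<lambda>(n, n') (m, m'). (Comp C n m, Comp D n' m'))\<rparr>"

definition cat_power ::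
  "'i set \<Rightarrow> ('o, 'm) small_category \<Rightarrow> ('i \<Rightarrow> 'o, 'i \<Rightarrow> 'm) small_category" where
  "cat_power I C =
     \<lparr>Obj = I \<rightarrow>\<^sub>E Obj C, Arr = I \<rightarrow>\<^sub>E Arr C,
      Dom = (\<lambda>m. \<lambda>i\<in>I. Dom C (m i)), Cod = (\<lambda>m. \<lambda>i\<in>I. Cod C (m i)),
      Ident = (\<lambda>x. \<lambda>i\<in>I. Ident C (x i)),
      Comp = (\<lambda>n m. \<lambda>i\<in>I. Comp C (n i) (m i))\<rparr>"

definition cat_equaliser ::
  "('o, 'm) small_category \<Rightarrow> ('o, 'm, 'p, 'n) functor_maps \<Rightarrow> ('o, 'm, 'p, 'n) functor_maps
     \<Rightarrow> ('o, 'm) small_category" where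
  "cat_equaliser C F G =
     C\<lparr>Obj := {x \<in> Obj C. fst F x = fst G x}, Arr := {m \<in> Arr C. snd F m = snd G m}\<rparr>"

definition subcategory :: "('o, 'm) small_category \<Rightarrow> 'o set \<Rightarrow> 'm set \<Rightarrow> bool" where
  "subcategory C X M \<longleftrightarrow> X \<subseteq> Obj C \<and> M \<subseteq> Arr C \<and>
     (\<forall>m\<in>M. Dom C m \<in> X \<and> Cod C m \<in> X) \<and> (\<forall>x\<in>X. Ident C x \<in> M) \<and>
     (\<forall>m\<in>M. \<forall>n\<in>M. Cod C m = Dom C n \<longrightarrow> Comp C n m \<in> M)"

text \<open>The image in Cat: the smallest subcategory of the codomain through which the functor
  factorises.  The functor need not be surjective on its arrows.\<close>

definition cat_image ::
  "('o, 'm) small_category \<Rightarrow> ('p, 'n) small_category \<Rightarrow> ('o, 'm, 'p, 'n) functor_maps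
     \<Rightarrow> ('p, 'n) small_category" where
  "cat_image C D F =
     D\<lparr>Obj := \<Inter>{X. \<exists>M. subcategory D X M \<and> fst F ` Obj C \<subseteq> X \<and> snd F ` Arr C \<subseteq> M},
       Arr := \<Inter>{M. \<exists>X. subcategory D X M \<and> fst F ` Obj C \<subseteq> X \<and> snd F ` Arr C \<subseteq> M}\<rparr>"

subsection \<open>Coequalisers in Cat\<close>

text \<open>Let \<open>F\<close> and \<open>G\<close> be functors from \<open>C\<close> to \<open>D\<close>.  The objects of their coequaliser are the classes
  of objects of \<open>D\<close> under the equivalence relation generated by \<open>F x \<sim> G x\<close>.  Arrows of \<open>D\<close> whose ends
  are merely equivalent become composable, so an arrow is a class of paths \<open>(X, ms, Y)\<close>, where the
  list \<open>ms\<close> of arrows of \<open>D\<close>, in the order in which they are traversed, leads from \<open>X\<close> to \<open>Y\<close>.\<close>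

definition coeq_obj_rel ::
  "('c, 'k) small_category \<Rightarrow> ('c, 'k, 'o, 'm) functor_maps \<Rightarrow> ('c, 'k, 'o, 'm) functor_maps
     \<Rightarrow> 'o rel" where
  "coeq_obj_rel C F G = (let R = {(fst F x, fst G x) | x. x \<in> Obj C} in (R \<union> R\<inverse>)\<^sup>*)"

context
  fixes C :: "('c, 'k) small_category" and D :: "('o, 'm) small_category"
    and F G :: "('c, 'k, 'o, 'm) functor_maps"
begin

definition coeq_obj :: "'o \<Rightarrow> 'o set" where
  "coeq_obj x = coeq_obj_rel C F G `` {x}"

fun coeq_path :: "'o set \<times> 'm list \<times> 'o set \<Rightarrow> bool" where
  "coeq_path (X, [], Y) \<longleftrightarrow> X \<in> coeq_obj ` Obj D \<and> X = Y"
| "coeq_path (X, m # ms, Y) \<longleftrightarrow>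
     m \<in> Arr D \<and> X = coeq_obj (Dom D m) \<and> coeq_path (coeq_obj (Cod D m), ms, Y)"

inductive coeq_step :: "'m list \<Rightarrow> 'm list \<Rightarrow> bool" where
  "\<lbrakk>m \<in> Arr D; n \<in> Arr D; Cod D m = Dom D n\<rbrakk>
     \<Longrightarrow> coeq_step (us @ [m, n] @ vs) (us @ [Comp D n m] @ vs)"
| "x \<in> Obj D \<Longrightarrow> coeq_step (us @ [Ident D x] @ vs) (us @ vs)"
| "k \<in> Arr C \<Longrightarrow> coeq_step (us @ [snd F k] @ vs) (us @ [snd G k] @ vs)"

definition coeq_arr_rel :: "('o set \<times> 'm list \<times> 'o set) rel" where
  "coeq_arr_rel =
     (let R = {((X, ms, Y), (X, ns, Y)) | X ms ns Y.
                 coeq_path (X, ms, Y) \<and> coeq_path (X, ns, Y) \<and> coeq_step ms ns}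
      in (R \<union> R\<inverse>)\<^sup>*)"

definition coeq_arr :: "'o set \<times> 'm list \<times> 'o set \<Rightarrow> ('o set \<times> 'm list \<times> 'o set) set" where
  "coeq_arr p = coeq_arr_rel `` {p}"

definition cat_coequaliser ::
  "('o set, ('o set \<times> 'm list \<times> 'o set) set) small_category" where
  "cat_coequaliser =
     \<lparr>Obj = coeq_obj ` Obj D,
      Arr = coeq_arr ` {p. coeq_path p},
      Dom = (\<lambda>P. the_elem (fst ` P)),
      Cod = (\<lambda>P. the_elem ((snd \<circ> snd) ` P)),
      Ident = (\<lambda>X. coeq_arr (X, [], X)),
      Comp = (\<lambda>Q P. \<Union>{coeq_arr (X, ms @ ns, Z) | X ms Y ns Z. (X, ms, Y) \<in> P \<and> (Y, ns, Z) \<in> Q})\<rparr>"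

definition coeq_functor ::
  "('o, 'm, 'o set, ('o set \<times> 'm list \<times> 'o set) set) functor_maps" where
  "coeq_functor =
     (coeq_obj, \<lambda>m. coeq_arr (coeq_obj (Dom D m), [m], coeq_obj (Cod D m)))"

end

section \<open>Crossed modules\<close>

record ('b, 'a) crossed_data =
  cm_B :: "'b monoid"
  cm_A :: "'a monoid"
  cm_act :: "'b \<Rightarrow> 'a \<Rightarrow> 'a"
  cm_bd :: "'a \<Rightarrow> 'b"

definition crossed_module :: "('b, 'a) crossed_data \<Rightarrow> bool" where
  "crossed_module H \<longleftrightarrow>
     (let A = cm_A H; B = cm_B H; act = cm_act H; bd = cm_bd H in
       group A \<and> group B \<and> bd \<in> hom A B \<and>
       (\<forall>b\<in>carrier B. act b \<in> hom A A) \<and>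
       (\<forall>a\<in>carrier A. act \<one>\<^bsub>B\<^esub> a = a) \<and>
       (\<forall>b\<in>carrier B. \<forall>b'\<in>carrier B. \<forall>a\<in>carrier A. act (b \<otimes>\<^bsub>B\<^esub> b') a = act b (act b' a)) \<and>
       (\<forall>b\<in>carrier B. \<forall>a\<in>carrier A. bd (act b a) = b \<otimes>\<^bsub>B\<^esub> bd a \<otimes>\<^bsub>B\<^esub> inv\<^bsub>B\<^esub> b) \<and>
       (\<forall>a\<in>carrier A. \<forall>a'\<in>carrier A. act (bd a) a' = a \<otimes>\<^bsub>A\<^esub> a' \<otimes>\<^bsub>A\<^esub> inv\<^bsub>A\<^esub> a))"

definition semidirect :: "('b, 'a) crossed_data \<Rightarrow> ('a \<times> 'b) monoid" where
  "semidirect H =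
     \<lparr>carrier = carrier (cm_A H) \<times> carrier (cm_B H),
      monoid.mult = (\<lambda>(a', b') (a, b).
        (a' \<otimes>\<^bsub>cm_A H\<^esub> cm_act H b' a, b' \<otimes>\<^bsub>cm_B H\<^esub> b)),
      one = (\<one>\<^bsub>cm_A H\<^esub>, \<one>\<^bsub>cm_B H\<^esub>)\<rparr>"

text \<open>The arrow \<open>(a, b)\<close> leads from \<open>b\<close> to \<open>\<partial>(a) b\<close>.  The group structure of this group object in Cat
  is that of \<open>cm_B H\<close> on objects and that of \<open>semidirect H\<close> on arrows.\<close>

definition cm_cat :: "('b, 'a) crossed_data \<Rightarrow> ('b, 'a \<times> 'b) small_category" where
  "cm_cat H =
     \<lparr>Obj = carrier (cm_B H),
      Arr = carrier (cm_A H) \<times> carrier (cm_B H),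
      Dom = snd,
      Cod = (\<lambda>(a, b). cm_bd H a \<otimes>\<^bsub>cm_B H\<^esub> b),
      Ident = (\<lambda>b. (\<one>\<^bsub>cm_A H\<^esub>, b)),
      Comp = (\<lambda>(a', b') (a, b). (a' \<otimes>\<^bsub>cm_A H\<^esub> a, b))\<rparr>"

section \<open>The protected object\<close>

datatype edge = Alpha nat | Beta nat

definition edges :: "nat \<Rightarrow> edge set" where
  "edges g = Alpha ` {1..g} \<union> Beta ` {1..g}"

definition commutator :: "('x, 'y) monoid_scheme \<Rightarrow> 'x \<Rightarrow> 'x \<Rightarrow> 'x" where
  "commutator G x y = x \<otimes>\<^bsub>G\<^esub> y \<otimes>\<^bsub>G\<^esub> inv\<^bsub>G\<^esub> x \<otimes>\<^bsub>G\<^esub> inv\<^bsub>G\<^esub> y"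

text \<open>\<open>[b\<^sub>g\<inverse>, a\<^sub>g] \<cdots> [b\<^sub>1\<inverse>, a\<^sub>1]\<close>, with the highest index leftmost.\<close>

primrec relator :: "('x, 'y) monoid_scheme \<Rightarrow> nat \<Rightarrow> (edge \<Rightarrow> 'x) \<Rightarrow> 'x" where
  "relator G 0 x = \<one>\<^bsub>G\<^esub>"
| "relator G (Suc n) x =
     commutator G (inv\<^bsub>G\<^esub> (x (Beta (Suc n)))) (x (Alpha (Suc n))) \<otimes>\<^bsub>G\<^esub> relator G n x"

definition conj_tuple :: "('x, 'y) monoid_scheme \<Rightarrow> nat \<Rightarrow> 'x \<times> (edge \<Rightarrow> 'x) \<Rightarrow> edge \<Rightarrow> 'x" where
  "conj_tuple G g = (\<lambda>(h, x). \<lambda>e\<in>edges g. h \<otimes>\<^bsub>G\<^esub> x e \<otimes>\<^bsub>G\<^esub> inv\<^bsub>G\<^esub> h)"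

definition tuple_cat ::
  "('b, 'a) crossed_data \<Rightarrow> nat \<Rightarrow> (edge \<Rightarrow> 'b, edge \<Rightarrow> 'a \<times> 'b) small_category" where
  "tuple_cat H g = cat_power (edges g) (cm_cat H)"

definition conj_functor where
  "conj_functor H g = (conj_tuple (cm_B H) g, conj_tuple (semidirect H) g)"

definition coinvariants ::
  "('b, 'a) crossed_data \<Rightarrow> nat \<Rightarrow> (edge \<Rightarrow> 'b, edge \<Rightarrow> 'a \<times> 'b) small_category" where
  "coinvariants H g =
     cat_equaliser (tuple_cat H g)
       (\<lambda>x. (relator (cm_B H) g x, x), \<lambda>m. (relator (semidirect H) g m, m))
       (\<lambda>x. (\<one>\<^bsub>cm_B H\<^esub>, x), \<lambda>m. (\<one>\<^bsub>semidirect H\<^esub>, m))"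

definition invariants where
  "invariants H g =
     cat_coequaliser (cat_prod (cm_cat H) (tuple_cat H g)) (tuple_cat H g)
       (conj_functor H g) (snd, snd)"

definition invariants_functor where
  "invariants_functor H g =
     coeq_functor (cat_prod (cm_cat H) (tuple_cat H g)) (tuple_cat H g)
       (conj_functor H g) (snd, snd)"

definition protected_object where
  "protected_object H g =
     cat_image (coinvariants H g) (invariants H g) (invariants_functor H g)"

section \<open>Closed surfaces\<close>

text \<open>A closed oriented surface of genus \<open>g\<close> is given by a characteristic map \<open>q\<close> of its \<open>2\<close>-cell: it
  is the quotient of the closed unit disc by the identification of the \<open>4g\<close> sides on the unit circle
  that read, counterclockwise from the point \<open>1\<close>,
  \<open>\<beta>\<^sub>g, \<alpha>\<^sub>g\<inverse>, \<beta>\<^sub>g\<inverse>, \<alpha>\<^sub>g, \<beta>\<^sub>g\<^sub>-\<^sub>1, \<dots>, \<beta>\<^sub>1, \<alpha>\<^sub>1\<inverse>, \<beta>\<^sub>1\<inverse>, \<alpha>\<^sub>1\<close>.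
  The sides form the standard graph with the single vertex \<open>q 1\<close>, the complement of the graph is the
  open disc \<open>q ` ball 0 1\<close>, and the orientation is that of the complex plane.  As the disc is compact
  and the target is Hausdorff, \<open>q\<close> is a quotient map onto its image.\<close>

definition side_point :: "nat \<Rightarrow> real \<Rightarrow> complex" where
  "side_point g s = cis (2 * pi * s / (4 * real g))"

text \<open>\<open>first_side g i\<close> is the number of the first of the four sides labelled by \<open>\<alpha>\<^sub>i\<close> and \<open>\<beta>\<^sub>i\<close>.\<close>

definition first_side :: "nat \<Rightarrow> nat \<Rightarrow> real" where
  "first_side g i = 4 * (real g - real i)"

definition side_identified :: "nat \<Rightarrow> complex \<Rightarrow> complex \<Rightarrow> bool" where
  "side_identified g x y \<longleftrightarrow>
     (\<exists>k l :: nat. x = side_point g (real k) \<and> y = side_point g (real l)) \<or>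
     (\<exists>i\<in>{1..g}. \<exists>t\<in>{0..1}.
        {x, y} = {side_point g (first_side g i + t), side_point g (first_side g i + 2 + (1 - t))} \<or>
        {x, y} = {side_point g (first_side g i + 3 + t), side_point g (first_side g i + 1 + (1 - t))})"

definition closed_surface :: "nat \<Rightarrow> (complex \<Rightarrow> 's::t2_space) \<Rightarrow> bool" where
  "closed_surface g q \<longleftrightarrow>
     continuous_on (cball 0 1) q \<and>
     (\<forall>x\<in>cball 0 1. \<forall>y\<in>cball 0 1. q x = q y \<longleftrightarrow> x = y \<or> side_identified g x y)"

definition surface :: "(complex \<Rightarrow> 's::t2_space) \<Rightarrow> 's set" where
  "surface q = q ` cball 0 1"

definition vertex :: "(complex \<Rightarrow> 's::t2_space) \<Rightarrow> 's" where
  "vertex q = q 1"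

fun standard_edge :: "nat \<Rightarrow> (complex \<Rightarrow> 's::t2_space) \<Rightarrow> edge \<Rightarrow> real \<Rightarrow> 's" where
  "standard_edge g q (Alpha i) = (\<lambda>t. q (side_point g (first_side g i + 3 + t)))"
| "standard_edge g q (Beta i) = (\<lambda>t. q (side_point g (first_side g i + t)))"

definition removed_disc :: "(complex \<Rightarrow> 's::t2_space) \<Rightarrow> 's set" where
  "removed_disc q = q ` ball 0 (1/2)"

definition disc_boundary :: "(complex \<Rightarrow> 's::t2_space) \<Rightarrow> 's set" where
  "disc_boundary q = q ` sphere 0 (1/2)"

definition punctured_surface :: "(complex \<Rightarrow> 's::t2_space) \<Rightarrow> 's set" where
  "punctured_surface q = surface q - removed_disc q"

text \<open>The cilium enters the face at the corner of the polygon between the incoming side \<open>\<alpha>\<^sub>1\<close> and the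
  outgoing side \<open>\<beta>\<^sub>g\<close>.\<close>

definition cilium :: "(complex \<Rightarrow> 's::t2_space) \<Rightarrow> real \<Rightarrow> 's" where
  "cilium q = (\<lambda>t. q (of_real (1 - t / 2)))"

section \<open>Fundamental group and mapping class groups\<close>

definition loops_at :: "'s::topological_space set \<Rightarrow> 's \<Rightarrow> (real \<Rightarrow> 's) set" where
  "loops_at S v = {p. path p \<and> path_image p \<subseteq> S \<and> pathstart p = v \<and> pathfinish p = v}"

definition path_class :: "'s::topological_space set \<Rightarrow> (real \<Rightarrow> 's) \<Rightarrow> (real \<Rightarrow> 's) set" where
  "path_class S p = {p'. homotopic_paths S p p'}"

text \<open>Products of path classes are read from right to left: \<open>[p] [p']\<close> is \<open>p'\<close> followed by \<open>p\<close>.\<close>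

definition fundamental_group :: "'s::topological_space set \<Rightarrow> 's \<Rightarrow> (real \<Rightarrow> 's) set monoid" where
  "fundamental_group S v =
     \<lparr>carrier = path_class S ` loops_at S v,
      monoid.mult = (\<lambda>X Y. \<Union>{path_class S (p' +++ p) | p p'. p \<in> X \<and> p' \<in> Y}),
      one = path_class S (\<lambda>_. v)\<rparr>"

abbreviation surface_group :: "(complex \<Rightarrow> 's::t2_space) \<Rightarrow> (real \<Rightarrow> 's) set monoid" where
  "surface_group q \<equiv> fundamental_group (surface q) (vertex q)"

definition generator :: "nat \<Rightarrow> (complex \<Rightarrow> 's::t2_space) \<Rightarrow> edge \<Rightarrow> (real \<Rightarrow> 's) set" where
  "generator g q e = path_class (surface q) (standard_edge g q e)"

text \<open>A homeomorphism of a closed oriented surface preserves the orientation iff it fixes the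
  fundamental class, which generates the second homology group.\<close>

definition orientation_preserving :: "'s::topological_space set \<Rightarrow> ('s \<Rightarrow> 's) \<Rightarrow> bool" where
  "orientation_preserving S f \<longleftrightarrow>
     (\<forall>c\<in>carrier (homology_group 2 (top_of_set S)).
        hom_induced 2 (top_of_set S) {} (top_of_set S) {} f c = c)"

definition surface_homeos :: "(complex \<Rightarrow> 's::t2_space) \<Rightarrow> ('s \<Rightarrow> 's) monoid" where
  "surface_homeos q = (let S = surface q in
     \<lparr>carrier = {f \<in> extensional S. (\<exists>f'. homeomorphism S S f f') \<and> orientation_preserving S f},
      monoid.mult = compose S,
      one = (\<lambda>x\<in>S. x)\<rparr>)"

definition null_homotopic_homeos :: "(complex \<Rightarrow> 's::t2_space) \<Rightarrow> ('s \<Rightarrow> 's) set" where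
  "null_homotopic_homeos q = {f \<in> carrier (surface_homeos q).
     homotopic_with_canon (\<lambda>_. True) (surface q) (surface q) f id}"

definition mapping_class_group :: "(complex \<Rightarrow> 's::t2_space) \<Rightarrow> ('s \<Rightarrow> 's) set monoid" where
  "mapping_class_group q = surface_homeos q Mod null_homotopic_homeos q"

text \<open>Homeomorphisms of the surface with boundary that fix the boundary pointwise automatically
  preserve the orientation.\<close>

definition punctured_homeos :: "(complex \<Rightarrow> 's::t2_space) \<Rightarrow> ('s \<Rightarrow> 's) monoid" where
  "punctured_homeos q = (let T = punctured_surface q in
     \<lparr>carrier = {f \<in> extensional T. (\<exists>f'. homeomorphism T T f f') \<and> (\<forall>x\<in>disc_boundary q. f x = x)},
      monoid.mult = compose T,
      one = (\<lambda>x\<in>T. x)\<rparr>)"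

definition null_homotopic_punctured_homeos :: "(complex \<Rightarrow> 's::t2_space) \<Rightarrow> ('s \<Rightarrow> 's) set" where
  "null_homotopic_punctured_homeos q = {f \<in> carrier (punctured_homeos q).
     homotopic_with_canon (\<lambda>h. \<forall>x\<in>disc_boundary q. h x = x)
       (punctured_surface q) (punctured_surface q) f id}"

definition punctured_mapping_class_group ::
  "(complex \<Rightarrow> 's::t2_space) \<Rightarrow> ('s \<Rightarrow> 's) set monoid" where
  "punctured_mapping_class_group q = punctured_homeos q Mod null_homotopic_punctured_homeos q"

definition extend_by_id :: "(complex \<Rightarrow> 's::t2_space) \<Rightarrow> ('s \<Rightarrow> 's) \<Rightarrow> 's \<Rightarrow> 's" where
  "extend_by_id q f = (\<lambda>x\<in>surface q. if x \<in> removed_disc q then x else f x)"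

definition cap_off :: "(complex \<Rightarrow> 's::t2_space) \<Rightarrow> ('s \<Rightarrow> 's) set \<Rightarrow> ('s \<Rightarrow> 's) set" where
  "cap_off q \<phi> =
     the_elem ((\<lambda>f. null_homotopic_homeos q #>\<^bsub>surface_homeos q\<^esub> extend_by_id q f) ` \<phi>)"

text \<open>An automorphism of the fundamental group represents a mapping class if it is induced by a
  homeomorphism \<open>h\<close> in the class and by a path \<open>p\<close> from the base point to its image under \<open>h\<close>.\<close>

definition represents ::
  "(complex \<Rightarrow> 's::t2_space) \<Rightarrow> ((real \<Rightarrow> 's) set \<Rightarrow> (real \<Rightarrow> 's) set) \<Rightarrow> ('s \<Rightarrow> 's) set \<Rightarrow> bool" where
  "represents q \<psi> \<phi> \<longleftrightarrow> \<psi> \<in> iso (surface_group q) (surface_group q) \<and>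
     (\<exists>h\<in>\<phi>. \<exists>p. path p \<and> path_image p \<subseteq> surface q \<and>
        pathstart p = vertex q \<and> pathfinish p = h (vertex q) \<and>
        (\<forall>c\<in>loops_at (surface q) (vertex q).
           \<psi> (path_class (surface q) c) = path_class (surface q) (p +++ (h \<circ> c) +++ reversepath p)))"

definition conj_class ::
  "('x, 'y) monoid_scheme \<Rightarrow> ('z, 'w) monoid_scheme \<Rightarrow> ('x \<Rightarrow> 'z) \<Rightarrow> ('x \<Rightarrow> 'z) set" where
  "conj_class K G \<tau> = {\<sigma> \<in> hom K G.
     \<exists>h\<in>carrier G. \<forall>x\<in>carrier K. \<sigma> x = h \<otimes>\<^bsub>G\<^esub> \<tau> x \<otimes>\<^bsub>G\<^esub> inv\<^bsub>G\<^esub> h}"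

text \<open>The classes \<open>[\<tau> \<circ> \<psi>\<inverse>]\<close> for the representatives \<open>\<tau>\<close> of \<open>X\<close> and \<open>\<psi>\<close> of \<open>\<phi>\<close> all agree.\<close>

definition mcg_act_rep ::
  "(complex \<Rightarrow> 's::t2_space) \<Rightarrow> ('z, 'w) monoid_scheme \<Rightarrow> ('s \<Rightarrow> 's) set
     \<Rightarrow> ((real \<Rightarrow> 's) set \<Rightarrow> 'z) set \<Rightarrow> ((real \<Rightarrow> 's) set \<Rightarrow> 'z) set" where
  "mcg_act_rep q G \<phi> X =
     \<Union>{conj_class (surface_group q) G (\<tau> \<circ> inv_into (carrier (surface_group q)) \<psi>) | \<tau> \<psi>.
         \<tau> \<in> X \<and> represents q \<psi> \<phi>}"

definition represented_arrow where
  "represented_arrow H g q \<tau> = snd (invariants_functor H g) (\<lambda>e\<in>edges g. \<tau> (generator g q e))"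

section \<open>Edge slides\<close>

datatype edge_end = Start edge | Target edge

text \<open>An edge with a choice of orientation; \<open>False\<close> stands for the reversed edge.\<close>

type_synonym oriented_edge = "edge \<times> bool"

definition start_end :: "oriented_edge \<Rightarrow> edge_end" where
  "start_end a = (if snd a then Start (fst a) else Target (fst a))"

definition target_end :: "oriented_edge \<Rightarrow> edge_end" where
  "target_end a = (if snd a then Target (fst a) else Start (fst a))"

text \<open>The counterclockwise order of the edge ends of the standard graph at the vertex, starting at
  the cilium.  It is determined by the identification of sides in \<^const>\<open>closed_surface\<close>, and hence
  by the relator: with products of path classes read from right to left, as required for a slide of
  \<open>\<beta>\<close> along \<open>\<alpha>\<close> to yield the class \<open>\<alpha>\<beta>\<close>, the boundary of the face yields the relator
  \<open>[\<beta>\<^sub>g\<inverse>, \<alpha>\<^sub>g] \<cdots> [\<beta>\<^sub>1\<inverse>, \<alpha>\<^sub>1]\<close> if the target ends of \<open>\<alpha>\<^sub>i\<close> and \<open>\<beta>\<^sub>i\<close> precede their starting ends.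
  If the starting ends preceded the target ends, sequences of slides that return to the initial order
  would in general not even preserve the triviality of this relator: for \<open>g = 2\<close>, sliding the target
  end of \<open>\<alpha>\<^sub>1\<close> along \<open>\<beta>\<^sub>1\<close> would conjugate the factor \<open>[\<beta>\<^sub>1\<inverse>, \<alpha>\<^sub>1]\<close> alone by \<open>\<beta>\<^sub>1\<close>.\<close>

definition standard_order :: "nat \<Rightarrow> edge_end list" where
  "standard_order g =
     concat (map (\<lambda>i. [Target (Alpha i), Target (Beta i), Start (Alpha i), Start (Beta i)]) [1..<Suc g])"

definition oriented_path :: "(edge \<Rightarrow> real \<Rightarrow> 's::topological_space) \<Rightarrow> oriented_edge \<Rightarrow> real \<Rightarrow> 's" where
  "oriented_path \<gamma> a = (if snd a then \<gamma> (fst a) else reversepath (\<gamma> (fst a)))"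

definition embedded_graph ::
  "nat \<Rightarrow> (complex \<Rightarrow> 's::t2_space) \<Rightarrow> (edge \<Rightarrow> real \<Rightarrow> 's) \<Rightarrow> bool" where
  "embedded_graph g q \<gamma> \<longleftrightarrow>
     (\<forall>e\<in>edges g. simple_path (\<gamma> e) \<and> pathstart (\<gamma> e) = vertex q \<and> pathfinish (\<gamma> e) = vertex q \<and>
        path_image (\<gamma> e) \<subseteq> punctured_surface q - disc_boundary q \<and>
        path_image (\<gamma> e) \<inter> path_image (cilium q) = {vertex q}) \<and>
     (\<forall>e\<in>edges g. \<forall>e'\<in>edges g. e \<noteq> e' \<longrightarrow>
        path_image (\<gamma> e) \<inter> path_image (\<gamma> e') = {vertex q})"

definition order_slide ::
  "oriented_edge \<Rightarrow> oriented_edge \<Rightarrow> edge_end list \<Rightarrow> edge_end list \<Rightarrow> bool" where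
  "order_slide a b L L' \<longleftrightarrow>
     (\<exists>us vs. L = us @ [start_end a, target_end b] @ vs) \<and>
     (\<exists>us vs. remove1 (target_end b) L = us @ [target_end a] @ vs \<and>
              L' = us @ [target_end b, target_end a] @ vs)"

text \<open>Sliding the target end of \<open>b\<close> along \<open>a\<close> yields an edge \<open>b'\<close> that runs parallel to \<open>b\<close> and then
  to \<open>a\<close>: the three edges bound a triangle whose interior does not meet the graphs or the cilium.\<close>

definition graph_slide ::
  "nat \<Rightarrow> (complex \<Rightarrow> 's::t2_space) \<Rightarrow> oriented_edge \<Rightarrow> oriented_edge
     \<Rightarrow> (edge \<Rightarrow> real \<Rightarrow> 's) \<Rightarrow> (edge \<Rightarrow> real \<Rightarrow> 's) \<Rightarrow> bool" where
  "graph_slide g q a b \<gamma> \<gamma>' \<longleftrightarrow>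
     embedded_graph g q \<gamma> \<and> embedded_graph g q \<gamma>' \<and>
     (\<forall>e\<in>edges g - {fst b}. \<gamma>' e = \<gamma> e) \<and>
     (\<exists>T. let \<Delta> = convex hull {0, 1, \<i>} in
        continuous_on \<Delta> T \<and> T ` \<Delta> \<subseteq> punctured_surface q \<and> inj_on T (interior \<Delta>) \<and>
        T ` interior \<Delta> \<inter> ((\<Union>e\<in>edges g. path_image (\<gamma> e) \<union> path_image (\<gamma>' e))
                             \<union> path_image (cilium q)) = {} \<and>
        (\<forall>t\<in>{0..1}. T (linepath 0 1 t) = oriented_path \<gamma> b t \<and>
                    T (linepath 1 \<i> t) = oriented_path \<gamma> a t \<and>
                    T (linepath 0 \<i> t) = oriented_path \<gamma>' b t))"

datatype slide = Slide oriented_edge oriented_edge | Inverse_Slide oriented_edge oriented_edge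

text \<open>The state of a sequence of slides is an embedded graph with the linear order of its edge ends.\<close>

definition basic_move ::
  "nat \<Rightarrow> (complex \<Rightarrow> 's::t2_space) \<Rightarrow> oriented_edge \<Rightarrow> oriented_edge
     \<Rightarrow> edge_end list \<times> (edge \<Rightarrow> real \<Rightarrow> 's) \<Rightarrow> edge_end list \<times> (edge \<Rightarrow> real \<Rightarrow> 's) \<Rightarrow> bool" where
  "basic_move g q a b X Y \<longleftrightarrow>
     fst a \<in> edges g \<and> fst b \<in> edges g \<and> fst a \<noteq> fst b \<and>
     order_slide a b (fst X) (fst Y) \<and> graph_slide g q a b (snd X) (snd Y)"

fun slide_move ::
  "nat \<Rightarrow> (complex \<Rightarrow> 's::t2_space) \<Rightarrow> slide \<Rightarrow> edge_end list \<times> (edge \<Rightarrow> real \<Rightarrow> 's)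
     \<Rightarrow> edge_end list \<times> (edge \<Rightarrow> real \<Rightarrow> 's) \<Rightarrow> bool" where
  "slide_move g q (Slide a b) X Y \<longleftrightarrow> basic_move g q a b X Y"
| "slide_move g q (Inverse_Slide a b) X Y \<longleftrightarrow> basic_move g q a b Y X"

fun slide_sequence ::
  "nat \<Rightarrow> (complex \<Rightarrow> 's::t2_space) \<Rightarrow> slide list \<Rightarrow> edge_end list \<times> (edge \<Rightarrow> real \<Rightarrow> 's)
     \<Rightarrow> edge_end list \<times> (edge \<Rightarrow> real \<Rightarrow> 's) \<Rightarrow> bool" where
  "slide_sequence g q [] X Y \<longleftrightarrow> X = Y"
| "slide_sequence g q (s # ss) X Y \<longleftrightarrow> (\<exists>Z. slide_move g q s X Z \<and> slide_sequence g q ss Z Y)"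

text \<open>Fixing the boundary of the disc determines the mapping class of \<open>f\<close> only up to the Dehn twist
  about this boundary; this ambiguity is removed by requiring that \<open>f\<close> also fix the cilium.\<close>

definition realises ::
  "nat \<Rightarrow> (complex \<Rightarrow> 's::t2_space) \<Rightarrow> slide list \<Rightarrow> ('s \<Rightarrow> 's) set \<Rightarrow> bool" where
  "realises g q ss \<phi> \<longleftrightarrow>
     (\<exists>\<gamma> f. slide_sequence g q ss (standard_order g, standard_edge g q) (standard_order g, \<gamma>) \<and>
        f \<in> carrier (punctured_homeos q) \<and>
        (\<forall>t\<in>{0..1}. f (cilium q t) = cilium q t) \<and>
        (\<forall>e\<in>edges g. \<forall>t\<in>{0..1}. f (standard_edge g q e t) = \<gamma> e t) \<and>
        \<phi> = inv\<^bsub>punctured_mapping_class_group q\<^esub>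
              (null_homotopic_punctured_homeos q #>\<^bsub>punctured_homeos q\<^esub> f))"

definition oriented_value :: "('x, 'y) monoid_scheme \<Rightarrow> (edge \<Rightarrow> 'x) \<Rightarrow> oriented_edge \<Rightarrow> 'x" where
  "oriented_value G x a = (if snd a then x (fst a) else inv\<^bsub>G\<^esub> (x (fst a)))"

definition set_value ::
  "('x, 'y) monoid_scheme \<Rightarrow> (edge \<Rightarrow> 'x) \<Rightarrow> oriented_edge \<Rightarrow> 'x \<Rightarrow> edge \<Rightarrow> 'x" where
  "set_value G x a y = x(fst a := (if snd a then y else inv\<^bsub>G\<^esub> y))"

fun slide_map :: "('x, 'y) monoid_scheme \<Rightarrow> slide \<Rightarrow> (edge \<Rightarrow> 'x) \<Rightarrow> edge \<Rightarrow> 'x" where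
  "slide_map G (Slide a b) x =
     set_value G x b (oriented_value G x a \<otimes>\<^bsub>G\<^esub> oriented_value G x b)"
| "slide_map G (Inverse_Slide a b) x =
     set_value G x b (inv\<^bsub>G\<^esub> (oriented_value G x a) \<otimes>\<^bsub>G\<^esub> oriented_value G x b)"

text \<open>The composite in which the map of the first slide is applied first.\<close>

definition slides_functor where
  "slides_functor H ss = (fold (slide_map (cm_B H)) ss, fold (slide_map (semidirect H)) ss)"

text \<open>The automorphism induced by a sequence of slides is characterised by its compatibility with the
  epimorphism from the coinvariants to the protected object.\<close>

definition induced_automorphism where
  "induced_automorphism H g ss \<Psi> \<longleftrightarrow>
     category_automorphism (protected_object H g) \<Psi> \<and>
     (\<forall>x\<in>Obj (coinvariants H g).
        fst (slides_functor H ss) x \<in> Obj (coinvariants H g) \<and>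
        fst \<Psi> (fst (invariants_functor H g) x)
          = fst (invariants_functor H g) (fst (slides_functor H ss) x)) \<and>
     (\<forall>m\<in>Arr (coinvariants H g).
        snd (slides_functor H ss) m \<in> Arr (coinvariants H g) \<and>
        snd \<Psi> (snd (invariants_functor H g) m)
          = snd (invariants_functor H g) (snd (slides_functor H ss) m))"

definition edge_slide_action where
  "edge_slide_action H g q \<Phi> \<longleftrightarrow>
     (\<forall>\<phi>\<in>carrier (mapping_class_group q).
        \<exists>\<phi>'\<in>carrier (punctured_mapping_class_group q). cap_off q \<phi>' = \<phi> \<and>
          (\<exists>ss. realises g q ss \<phi>' \<and> induced_automorphism H g ss (\<Phi> \<phi>)))"

end

theory Submission
  imports Defs
begin

text \<open>A slide of \<open>b\<close> along \<open>a\<close> is realised by a triangle in the surface, so the path classes of the edges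
  change by \<open>[b] \<mapsto> [a][b]\<close>, exactly as the slide map prescribes.  Hence a sequence of slides from the
  standard graph to its image under \<open>f\<close> sends the tuple of values of \<open>\<tau>\<close> on the generators to the tuple
  of values of \<open>\<tau> \<circ> f\<^sub>*\<close>.  The sequence realises \<open>\<phi> = [f]\<inverse>\<close>, and a homeomorphism homotopic to the
  identity acts on the fundamental group by conjugation up to a change of base path, so that
  \<open>\<tau> \<circ> f\<^sub>*\<close> is conjugate to every representative of \<open>\<phi> \<triangleright> [\<tau>]\<close>.  Finally, conjugate tuples are identified
  in the coequaliser defining the invariants.\<close>

section \<open>The projection to the invariants\<close>

text \<open>The coequaliser identifies a tuple with its conjugate by one arrow of \<open>H\<close>,
  so a single element of \<open>semidirect H\<close> must serve for all edges. Three conjugations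
  are therefore merged before edges are considered: the choice of a representative of the class of
  \<tau>, the choice of \<sigma> in the resulting class, and the loop formed by the base path and
  the track of the vertex. Two inversions cancel: one from the meaning of realising a mapping class,
  one from the action by precomposition with an inverse. The homeomorphism \<open>f\<close> lives on
  the surface with a disc removed, whereas \<phi> is a class on the closed surface. So
  \<open>f\<close> is continued by the identity, and inverses of cosets are followed through this
  continuation; the normal subgroups of null-homotopic homeomorphisms serve this purpose. The
  induced automorphism is prescribed on the image of the coinvariants, so the generators must
  satisfy the surface relation; it is obtained by contracting the boundary of the polygon in the
  disc.\<close>

lemma Image_rtrancl_sym_eq:
  assumes "sym R" "(x, y) \<in> R\<^sup>*"
  shows "R\<^sup>* `` {x} = R\<^sup>* `` {y}"
  using assms sym_rtrancl[OF assms(1)] by (auto dest: symD intro: rtrancl_trans)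

lemma coeq_obj_eq:
  assumes "x \<in> Obj C"
  shows "coeq_obj C F G (fst F x) = coeq_obj C F G (fst G x)"
  unfolding coeq_obj_def coeq_obj_rel_def Let_def
  by (rule Image_rtrancl_sym_eq) (use assms in \<open>auto simp: sym_Un_converse intro!: r_into_rtrancl\<close>)

lemma coeq_arr_eq:
  assumes "coeq_path C D F G (X, ms, Y)" "coeq_path C D F G (X, ns, Y)" "coeq_step C D F G ms ns"
  shows "coeq_arr C D F G (X, ms, Y) = coeq_arr C D F G (X, ns, Y)"
  unfolding coeq_arr_def coeq_arr_rel_def Let_def
  by (rule Image_rtrancl_sym_eq) (use assms in \<open>auto simp: sym_Un_converse intro!: r_into_rtrancl\<close>)

text \<open>The one-arrow paths on \<open>snd F k\<close> and \<open>snd G k\<close> differ by the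
  third kind of \<open>coeq_step\<close>. Such a step relates only paths with the same end classes,
  so the ends of the two arrows are identified beforehand.\<close>

lemma coeq_functor_arr_eq:
  assumes "k \<in> Arr C" "Dom C k \<in> Obj C" "Cod C k \<in> Obj C"
    and F: "snd F k \<in> Arr D" "Dom D (snd F k) = fst F (Dom C k)" "Cod D (snd F k) = fst F (Cod C k)"
      "fst F (Cod C k) \<in> Obj D"
    and G: "snd G k \<in> Arr D" "Dom D (snd G k) = fst G (Dom C k)" "Cod D (snd G k) = fst G (Cod C k)"
  shows "snd (coeq_functor C D F G) (snd F k) = snd (coeq_functor C D F G) (snd G k)"
proof -
  have dom: "coeq_obj C F G (Dom D (snd G k)) = coeq_obj C F G (Dom D (snd F k))"
    and cod: "coeq_obj C F G (Cod D (snd G k)) = coeq_obj C F G (Cod D (snd F k))"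
    using assms coeq_obj_eq[of _ C F G] by simp_all
  have "coeq_step C D F G [snd F k] [snd G k]"
    using coeq_step.intros(3)[OF assms(1), of D F G "[]" "[]"] by simp
  then show ?thesis
    unfolding coeq_functor_def snd_conv dom cod
    by (intro coeq_arr_eq) (use F G dom cod in auto)
qed

section \<open>The group object in Cat given by a crossed module, and conjugation of tuples\<close>

lemma crossed_module_simps:
  assumes "crossed_module H"
  shows "group (cm_A H)" "group (cm_B H)" "cm_bd H \<in> hom (cm_A H) (cm_B H)"
    "\<And>b. b \<in> carrier (cm_B H) \<Longrightarrow> cm_act H b \<in> hom (cm_A H) (cm_A H)"
    "\<And>a. a \<in> carrier (cm_A H) \<Longrightarrow> cm_act H \<one>\<^bsub>cm_B H\<^esub> a = a"
    "\<And>b b' a. \<lbrakk>b \<in> carrier (cm_B H); b' \<in> carrier (cm_B H); a \<in> carrier (cm_A H)\<rbrakk>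
       \<Longrightarrow> cm_act H (b \<otimes>\<^bsub>cm_B H\<^esub> b') a = cm_act H b (cm_act H b' a)"
    "\<And>b a. \<lbrakk>b \<in> carrier (cm_B H); a \<in> carrier (cm_A H)\<rbrakk>
       \<Longrightarrow> cm_bd H (cm_act H b a) = b \<otimes>\<^bsub>cm_B H\<^esub> cm_bd H a \<otimes>\<^bsub>cm_B H\<^esub> inv\<^bsub>cm_B H\<^esub> b"
  using assms by (auto simp: crossed_module_def Let_def)

lemma group_semidirect:
  assumes "crossed_module H"
  shows "group (semidirect H)"
proof -
  interpret A: group "cm_A H" by (rule crossed_module_simps(1)[OF assms])
  interpret B: group "cm_B H" by (rule crossed_module_simps(2)[OF assms])
  note act = crossed_module_simps(4-6)[OF assms]
  have closed: "cm_act H b a \<in> carrier (cm_A H)"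
    if "b \<in> carrier (cm_B H)" "a \<in> carrier (cm_A H)" for a b
    using act(1)[OF that(1)] that(2) by (rule hom_in_carrier)
  have mult: "cm_act H b (a \<otimes>\<^bsub>cm_A H\<^esub> a') = cm_act H b a \<otimes>\<^bsub>cm_A H\<^esub> cm_act H b a'"
    if "b \<in> carrier (cm_B H)" "a \<in> carrier (cm_A H)" "a' \<in> carrier (cm_A H)" for a a' b
    using act(1)[OF that(1)] that(2,3) by (rule hom_mult)
  show ?thesis
  proof (rule groupI)
    fix x assume "x \<in> carrier (semidirect H)"
    then obtain a b where x: "x = (a, b)" "a \<in> carrier (cm_A H)" "b \<in> carrier (cm_B H)"
      by (auto simp: semidirect_def)
    let ?b = "inv\<^bsub>cm_B H\<^esub> b"
    \<comment> \<open>The left inverse of (a, b) has second component b^-1 and first component b^-1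
      acting on a^-1. The first component of the product is checked by pulling the action of b^-1
      out.\<close>
    have "cm_act H ?b (inv\<^bsub>cm_A H\<^esub> a) \<otimes>\<^bsub>cm_A H\<^esub> cm_act H ?b a
        = cm_act H ?b (inv\<^bsub>cm_A H\<^esub> a \<otimes>\<^bsub>cm_A H\<^esub> a)"
      using x by (simp add: mult[symmetric])
    also have "\<dots> = \<one>\<^bsub>cm_A H\<^esub>"
      using x act(1)[of ?b] A.group_axioms by (simp add: hom_one)
    finally show "\<exists>y\<in>carrier (semidirect H). y \<otimes>\<^bsub>semidirect H\<^esub> x = \<one>\<^bsub>semidirect H\<^esub>"
      using x closed[of ?b "inv\<^bsub>cm_A H\<^esub> a"]
      by (intro bexI[of _ "(cm_act H ?b (inv\<^bsub>cm_A H\<^esub> a), ?b)"]) (auto simp: semidirect_def)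
  qed (auto simp: semidirect_def closed mult act(2) act(3) A.m_assoc B.m_assoc)
qed

lemma hom_Dom_cm_cat: "Dom (cm_cat H) \<in> hom (semidirect H) (cm_B H)"
  by (auto simp: hom_def semidirect_def cm_cat_def)

text \<open>Multiplicativity of the target map is the equivariance of the boundary: the action of b'
  becomes conjugation by b', whose right factor cancels against the second component b' b.\<close>

lemma hom_Cod_cm_cat:
  assumes "crossed_module H"
  shows "Cod (cm_cat H) \<in> hom (semidirect H) (cm_B H)"
proof -
  note H = crossed_module_simps[OF assms]
  interpret B: group "cm_B H" by (rule H(2))
  have bd: "cm_bd H a \<in> carrier (cm_B H)" if "a \<in> carrier (cm_A H)" for a
    using H(3) that by (rule hom_in_carrier)
  have closed: "cm_act H b a \<in> carrier (cm_A H)"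
    if "b \<in> carrier (cm_B H)" "a \<in> carrier (cm_A H)" for a b
    using H(4)[OF that(1)] that(2) by (rule hom_in_carrier)
  have "cm_bd H (a' \<otimes>\<^bsub>cm_A H\<^esub> cm_act H b' a) \<otimes>\<^bsub>cm_B H\<^esub> (b' \<otimes>\<^bsub>cm_B H\<^esub> b)
      = cm_bd H a' \<otimes>\<^bsub>cm_B H\<^esub> b' \<otimes>\<^bsub>cm_B H\<^esub> (cm_bd H a \<otimes>\<^bsub>cm_B H\<^esub> b)"
    if "a \<in> carrier (cm_A H)" "a' \<in> carrier (cm_A H)" "b \<in> carrier (cm_B H)" "b' \<in> carrier (cm_B H)"
    for a a' b b'
  proof -
    have "cm_bd H (a' \<otimes>\<^bsub>cm_A H\<^esub> cm_act H b' a) \<otimes>\<^bsub>cm_B H\<^esub> (b' \<otimes>\<^bsub>cm_B H\<^esub> b)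
        = cm_bd H a' \<otimes>\<^bsub>cm_B H\<^esub> (b' \<otimes>\<^bsub>cm_B H\<^esub> cm_bd H a \<otimes>\<^bsub>cm_B H\<^esub> inv\<^bsub>cm_B H\<^esub> b')
            \<otimes>\<^bsub>cm_B H\<^esub> (b' \<otimes>\<^bsub>cm_B H\<^esub> b)"
      using that closed by (simp add: hom_mult[OF H(3)] H(7))
    moreover have "inv\<^bsub>cm_B H\<^esub> b' \<otimes>\<^bsub>cm_B H\<^esub> (b' \<otimes>\<^bsub>cm_B H\<^esub> b) = b"
      using that by (simp add: B.m_assoc[symmetric])
    ultimately show ?thesis
      using that bd by (simp add: B.m_assoc)
  qed
  then show ?thesis
    using bd by (auto simp: hom_def semidirect_def cm_cat_def)
qed

text \<open>For \<open>f\<close> the source or target map of arrows, this is the compatibility of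
  conjugation with the ends of arrows.\<close>

lemma hom_conj_tuple:
  assumes "f \<in> hom G K" "group G" "group K" "h \<in> carrier G" "x \<in> edges g \<rightarrow>\<^sub>E carrier G"
  shows "(\<lambda>e\<in>edges g. f (conj_tuple G g (h, x) e)) = conj_tuple K g (f h, \<lambda>e\<in>edges g. f (x e))"
proof -
  interpret group_hom G K f
    using assms by (simp add: group_hom_def group_hom_axioms_def)
  show ?thesis
    using assms(4) PiE_mem[OF assms(5)] by (auto simp: conj_tuple_def intro!: restrict_ext)
qed

lemma conj_tuple_closed:
  assumes "group G" "h \<in> carrier G" "x \<in> edges g \<rightarrow>\<^sub>E carrier G"
  shows "conj_tuple G g (h, x) \<in> edges g \<rightarrow>\<^sub>E carrier G"
proof -
  interpret group G by (rule assms)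
  show ?thesis using assms(2) PiE_mem[OF assms(3)] by (auto simp: conj_tuple_def)
qed

text \<open>The pair (h, m) is an arrow of the product category on which the two coequalised
  functors take the conjugated tuple and \<open>m\<close> as values.\<close>

lemma invariants_functor_conj:
  assumes H: "crossed_module H"
    and h: "h \<in> carrier (semidirect H)" and m: "m \<in> edges g \<rightarrow>\<^sub>E carrier (semidirect H)"
  shows "snd (invariants_functor H g) (conj_tuple (semidirect H) g (h, m))
       = snd (invariants_functor H g) m"
proof -
  let ?C = "cat_prod (cm_cat H) (tuple_cat H g)" and ?D = "tuple_cat H g" and ?F = "conj_functor H g"
  have arr: "Arr (cm_cat H) = carrier (semidirect H)" and obj: "Obj (cm_cat H) = carrier (cm_B H)"
    by (auto simp: cm_cat_def semidirect_def)
  note grp = group_semidirect[OF H] crossed_module_simps(2)[OF H]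
  note dom = hom_Dom_cm_cat[of H] and cod = hom_Cod_cm_cat[OF H]
  have k: "(h, m) \<in> Arr ?C" "Dom ?C (h, m) \<in> Obj ?C" "Cod ?C (h, m) \<in> Obj ?C"
    using h m
    by (auto simp: cat_prod_def tuple_cat_def cat_power_def arr obj
        intro!: hom_in_carrier[OF dom] hom_in_carrier[OF cod])
  have "conj_tuple (cm_B H) g (Cod (cm_cat H) h, \<lambda>e\<in>edges g. Cod (cm_cat H) (m e))
      \<in> edges g \<rightarrow>\<^sub>E carrier (cm_B H)"
    by (intro conj_tuple_closed[OF grp(2)] restrict_PiE_iff[THEN iffD2] ballI
        hom_in_carrier[OF cod] h PiE_mem[OF m])
  then have F: "snd ?F (h, m) \<in> Arr ?D" "Dom ?D (snd ?F (h, m)) = fst ?F (Dom ?C (h, m))"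
    "Cod ?D (snd ?F (h, m)) = fst ?F (Cod ?C (h, m))" "fst ?F (Cod ?C (h, m)) \<in> Obj ?D"
    using conj_tuple_closed[OF grp(1) h m] hom_conj_tuple[OF dom grp h m] hom_conj_tuple[OF cod grp h m]
    by (simp_all add: cat_prod_def tuple_cat_def cat_power_def conj_functor_def arr obj)
  have G: "snd (snd, snd) (h, m) \<in> Arr ?D"
    "Dom ?D (snd (snd, snd) (h, m)) = fst (snd, snd) (Dom ?C (h, m))"
    "Cod ?D (snd (snd, snd) (h, m)) = fst (snd, snd) (Cod ?C (h, m))"
    using m by (auto simp: cat_prod_def tuple_cat_def cat_power_def arr)
  show ?thesis
    using coeq_functor_arr_eq[where F = ?F and G = "(snd, snd)" and k = "(h, m)", OF k F G]
    by (simp add: invariants_functor_def conj_functor_def)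
qed

section \<open>Relators\<close>

lemma edges_Suc: "edges (Suc n) = insert (Alpha (Suc n)) (insert (Beta (Suc n)) (edges n))"
  by (auto simp: edges_def atLeastAtMostSuc_conv)

lemma relator_cong:
  assumes "\<And>e. e \<in> edges n \<Longrightarrow> x e = y e"
  shows "relator G n x = relator G n y"
  using assms by (induction n) (auto simp: edges_Suc)

lemma (in group) relator_closed:
  assumes "\<And>e. e \<in> edges n \<Longrightarrow> x e \<in> carrier G"
  shows "relator G n x \<in> carrier G"
  using assms by (induction n) (auto simp: edges_Suc commutator_def)

lemma (in group_hom) hom_relator:
  assumes "\<And>e. e \<in> edges n \<Longrightarrow> x e \<in> carrier G"
  shows "h (relator G n x) = relator H n (\<lambda>e. h (x e))"
  using assms G.relator_closed by (induction n) (auto simp: edges_Suc commutator_def)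

section \<open>The fundamental group\<close>

text \<open>A convex set is simply connected, so a homotopy inside \<open>C\<close> comes for free
  and \<open>K\<close> carries it into \<open>S\<close>. The convex sets used are an interval, a
  square, the closed disc and a triangle.\<close>

lemma homotopic_paths_image_convex:
  fixes K :: "'a::real_normed_vector \<Rightarrow> 's::topological_space"
  assumes K: "convex C" "continuous_on C K" "K ` C \<subseteq> S"
    and p: "path p" "path_image p \<subseteq> C" and p': "path p'" "path_image p' \<subseteq> C"
    and "pathstart p = pathstart p'" "pathfinish p = pathfinish p'"
  shows "homotopic_paths S (K \<circ> p) (K \<circ> p')"
proof -
  have "homotopic_paths C p p'"
    using convex_imp_simply_connected[OF K(1)] assms by (metis simply_connected_eq_homotopic_paths)
  then show ?thesis
    by (rule homotopic_paths_continuous_image) (use K in auto)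
qed

lemma path_class_eqI: "homotopic_paths S p p' \<Longrightarrow> path_class S p = path_class S p'"
  unfolding path_class_def using homotopic_paths_sym homotopic_paths_trans by blast

lemma path_class_cong:
  assumes "p \<in> loops_at S v" "\<And>t. t \<in> {0..1} \<Longrightarrow> p t = p' t"
  shows "path_class S p = path_class S p'"
  using assms by (intro path_class_eqI homotopic_paths_eq) (auto simp: loops_at_def)

lemma loops_at_join: "\<lbrakk>p \<in> loops_at S v; p' \<in> loops_at S v\<rbrakk> \<Longrightarrow> p +++ p' \<in> loops_at S v"
  by (auto simp: loops_at_def path_image_join)

lemma loops_at_reversepath: "p \<in> loops_at S v \<Longrightarrow> reversepath p \<in> loops_at S v"
  by (auto simp: loops_at_def)

lemma loops_at_const: "v \<in> S \<Longrightarrow> (\<lambda>_. v) \<in> loops_at S v"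
  by (auto simp: loops_at_def path_def path_image_def pathstart_def pathfinish_def)

lemma loops_at_memD: "p \<in> loops_at S v \<Longrightarrow> v \<in> S"
  unfolding loops_at_def using pathstart_in_path_image by blast

lemma path_class_in_carrier: "p \<in> loops_at S v \<Longrightarrow> path_class S p \<in> carrier (fundamental_group S v)"
  by (simp add: fundamental_group_def)

text \<open>The product is a union over all representatives; homotopic factors have homotopic
  concatenations, so the union runs over one class only.\<close>

lemma fundamental_group_mult:
  assumes "p \<in> loops_at S v" "p' \<in> loops_at S v"
  shows "path_class S p \<otimes>\<^bsub>fundamental_group S v\<^esub> path_class S p' = path_class S (p' +++ p)"
proof -
  have "path_class S (r' +++ r) = path_class S (p' +++ p)"
    if "r \<in> path_class S p" "r' \<in> path_class S p'" for r r'
  proof -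
    have hom: "homotopic_paths S p r" "homotopic_paths S p' r'"
      using that by (simp_all add: path_class_def)
    have "homotopic_paths S (p' +++ p) (r' +++ r)"
      using assms by (intro homotopic_paths_join hom) (simp add: loops_at_def)
    then show ?thesis by (intro path_class_eqI[symmetric])
  qed
  moreover have "p \<in> path_class S p" "p' \<in> path_class S p'"
    using assms by (auto simp: path_class_def loops_at_def)
  ultimately have "{path_class S (r' +++ r) | r r'. r \<in> path_class S p \<and> r' \<in> path_class S p'}
      = {path_class S (p' +++ p)}"
    by blast
  then show ?thesis
    by (simp add: fundamental_group_def)
qed

text \<open>Running along \<open>p\<close> and back is \<open>p\<close> composed with the path
  through the unit interval and back, which contracts to 0 within the interval.\<close>

lemma homotopic_paths_reversepath_join:
  assumes "path p" "path_image p \<subseteq> S"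
  shows "homotopic_paths S (p +++ reversepath p) (\<lambda>_. pathstart p)"
proof -
  have "homotopic_paths S (p \<circ> (id +++ reversepath id)) (p \<circ> (\<lambda>_. 0))"
  proof (rule homotopic_paths_image_convex[where C = "{0..1::real}"])
    show "path_image (id +++ reversepath id) \<subseteq> {0..1::real}"
      by (auto simp: path_image_def joinpaths_def reversepath_def)
    show "path (id +++ reversepath id :: real \<Rightarrow> real)"
      by (intro path_join_imp) (auto simp: path_def pathstart_def pathfinish_def reversepath_def intro!: continuous_intros)
  qed (use assms in \<open>auto simp: path_def path_image_def pathstart_def pathfinish_def joinpaths_def reversepath_def\<close>)
  then show ?thesis
    by (simp add: path_compose_join path_compose_reversepath pathstart_def o_def[of p "\<lambda>_. 0"])
qed

lemma homotopic_paths_const_join: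
  assumes "path p" "path_image p \<subseteq> S"
  shows "homotopic_paths S (p +++ (\<lambda>_. pathfinish p)) p"
proof -
  have "homotopic_paths S (p \<circ> (id +++ (\<lambda>_. 1))) (p \<circ> id)"
  proof (rule homotopic_paths_image_convex[where C = "{0..1::real}"])
    show "path_image (id +++ (\<lambda>_. 1)) \<subseteq> {0..1::real}"
      by (auto simp: path_image_def joinpaths_def)
    show "path (id +++ (\<lambda>_. 1) :: real \<Rightarrow> real)"
      by (intro path_join_imp) (auto simp: path_def pathstart_def pathfinish_def intro!: continuous_intros)
    show "path_image id \<subseteq> {0..1::real}" by (simp add: path_image_def)
  qed (use assms in \<open>auto simp: path_def path_image_def pathstart_def pathfinish_def joinpaths_def intro!: continuous_intros\<close>)
  then show ?thesis
    by (simp add: path_compose_join pathfinish_def o_def[of p "\<lambda>_. 1"])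
qed

lemma carrier_fundamental_groupE:
  assumes "x \<in> carrier (fundamental_group S v)"
  obtains p where "p \<in> loops_at S v" "x = path_class S p"
  using assms by (auto simp: fundamental_group_def)

lemma fundamental_group_one: "\<one>\<^bsub>fundamental_group S v\<^esub> = path_class S (\<lambda>_. v)"
  by (simp add: fundamental_group_def)

text \<open>With products read from right to left, the left-hand side is the class of
  \<open>p\<close> followed by its reverse.\<close>

lemma fundamental_group_l_inv:
  assumes "p \<in> loops_at S v"
  shows "path_class S (reversepath p) \<otimes>\<^bsub>fundamental_group S v\<^esub> path_class S p = \<one>\<^bsub>fundamental_group S v\<^esub>"
  unfolding fundamental_group_mult[OF loops_at_reversepath[OF assms] assms] fundamental_group_one
  using assms homotopic_paths_reversepath_join[of p S] by (intro path_class_eqI) (auto simp: loops_at_def)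

lemma group_fundamental_group:
  assumes "v \<in> S"
  shows "group (fundamental_group S v)"
proof (rule groupI)
  let ?G = "fundamental_group S v"
  have const: "(\<lambda>_. v) \<in> loops_at S v" by (rule loops_at_const[OF assms])
  show "\<one>\<^bsub>?G\<^esub> \<in> carrier ?G"
    using path_class_in_carrier[OF const] by (simp add: fundamental_group_one)
  fix x assume "x \<in> carrier ?G"
  then obtain p where p: "p \<in> loops_at S v" "x = path_class S p" by (rule carrier_fundamental_groupE)
  show "\<one>\<^bsub>?G\<^esub> \<otimes>\<^bsub>?G\<^esub> x = x"
    unfolding p(2) fundamental_group_one fundamental_group_mult[OF const p(1)]
    using p(1) homotopic_paths_const_join[of p S] by (intro path_class_eqI) (auto simp: loops_at_def)
  show "\<exists>y\<in>carrier ?G. y \<otimes>\<^bsub>?G\<^esub> x = \<one>\<^bsub>?G\<^esub>"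
    using fundamental_group_l_inv[OF p(1)] path_class_in_carrier[OF loops_at_reversepath[OF p(1)]]
    unfolding p(2) by (rule bexI)
  fix y assume "y \<in> carrier ?G"
  then obtain p' where p': "p' \<in> loops_at S v" "y = path_class S p'" by (rule carrier_fundamental_groupE)
  show "x \<otimes>\<^bsub>?G\<^esub> y \<in> carrier ?G"
    unfolding p(2) p'(2) fundamental_group_mult[OF p(1) p'(1)]
    by (rule path_class_in_carrier[OF loops_at_join[OF p'(1) p(1)]])
  fix z assume "z \<in> carrier ?G"
  then obtain r where r: "r \<in> loops_at S v" "z = path_class S r" by (rule carrier_fundamental_groupE)
  have "homotopic_paths S (r +++ p' +++ p) ((r +++ p') +++ p)"
    using p(1) p'(1) r(1) by (intro homotopic_paths_assoc) (auto simp: loops_at_def)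
  from path_class_eqI[OF this] show "x \<otimes>\<^bsub>?G\<^esub> y \<otimes>\<^bsub>?G\<^esub> z = x \<otimes>\<^bsub>?G\<^esub> (y \<otimes>\<^bsub>?G\<^esub> z)"
    using p p' r by (simp add: fundamental_group_mult loops_at_join)
qed

lemma fundamental_group_inv:
  assumes "p \<in> loops_at S v"
  shows "inv\<^bsub>fundamental_group S v\<^esub> path_class S p = path_class S (reversepath p)"
proof -
  interpret group "fundamental_group S v"
    by (rule group_fundamental_group[OF loops_at_memD[OF assms]])
  show ?thesis
    using assms by (intro inv_equality fundamental_group_l_inv path_class_in_carrier loops_at_reversepath)
qed

text \<open>The two paths are the images of the two ways around the unit square under
  \<open>(t, s) \<mapsto> K (t, c s)\<close>, where \<open>K\<close> is the homotopy and \<open>d\<close> is the track \<open>t \<mapsto> K (t, v)\<close>.\<close>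

lemma homotopic_id_conjugates:
  assumes "homotopic_with_canon (\<lambda>_. True) S S n id" "v \<in> S"
  obtains d where "path d" "path_image d \<subseteq> S" "pathstart d = n v" "pathfinish d = v"
    "\<And>c. c \<in> loops_at S v \<Longrightarrow> homotopic_paths S (n \<circ> c) (d +++ c +++ reversepath d)"
proof -
  obtain K :: "real \<times> _ \<Rightarrow> _" where K: "continuous_on ({0..1} \<times> S) K" "K ` ({0..1} \<times> S) \<subseteq> S"
    and K0: "\<And>x. K (0, x) = n x" and K1: "\<And>x. K (1, x) = x"
    using assms(1) unfolding homotopic_with_def by (auto simp: subtopology_Times[symmetric] image_subset_iff_funcset)
  define d where "d = (\<lambda>t. K (t, v))"
  show ?thesis
  proof (rule that[of d])
    show "path d" unfolding d_def path_def
      by (intro continuous_on_compose2[OF K(1)] continuous_intros) (use assms(2) in auto)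
    show "path_image d \<subseteq> S" using K(2) assms(2) by (auto simp: d_def path_image_def)
    show "pathstart d = n v" "pathfinish d = v" by (simp_all add: d_def pathstart_def pathfinish_def K0 K1)
    fix c assume c: "c \<in> loops_at S v"
    define J where "J = (\<lambda>(t, s). K (t, c s))"
    define a1 a2 :: "real \<Rightarrow> real \<times> real" where "a1 = (\<lambda>t. (t, 0))" and "a2 = (\<lambda>t. (t, 1))"
    note a_def = a1_def a2_def
    have a: "path a1" "path a2" "path (Pair 1 :: real \<Rightarrow> real \<times> real)"
      unfolding a_def path_def by (intro continuous_intros)+
    have c': "continuous_on {0..1} c" "\<And>t. t \<in> {0..1} \<Longrightarrow> c t \<in> S" "c 0 = v" "c 1 = v"
      using c by (auto simp: loops_at_def path_def path_image_def pathstart_def pathfinish_def)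
    have "homotopic_paths S (J \<circ> Pair 0) (J \<circ> (a1 +++ Pair 1 +++ reversepath a2))"
    proof (rule homotopic_paths_image_convex[where C = "{0..1} \<times> {0..1::real}"])
      show "continuous_on ({0..1} \<times> {0..1}) J"
        unfolding J_def case_prod_unfold
        by (intro continuous_on_compose2[OF K(1)] continuous_intros continuous_on_compose2[OF c'(1)])
          (use c'(2) in auto)
      show "path (Pair 0 :: real \<Rightarrow> real \<times> real)"
        unfolding path_def by (intro continuous_intros)
      show "path (a1 +++ Pair 1 +++ reversepath a2)"
        using a by (intro path_join_imp) (simp_all add: a_def, simp_all add: pathstart_def pathfinish_def)
      have "path_image a1 \<subseteq> {0..1} \<times> {0..1}" "path_image a2 \<subseteq> {0..1} \<times> {0..1}"
          "path_image (Pair 1 :: real \<Rightarrow> real \<times> real) \<subseteq> {0..1} \<times> {0..1}"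
        by (auto simp: a_def path_image_def)
      then show "path_image (a1 +++ Pair 1 +++ reversepath a2) \<subseteq> {0..1} \<times> {0..1}"
        by (intro subset_path_image_join) simp_all
      show "J ` ({0..1} \<times> {0..1}) \<subseteq> S"
        using K(2) c'(2) by (fastforce simp: J_def)
    qed (auto simp: a_def path_image_def pathstart_def pathfinish_def joinpaths_def reversepath_def
        intro!: convex_Times)
    moreover have "J \<circ> Pair 0 = n \<circ> c" "J \<circ> Pair 1 = c" "J \<circ> a1 = d" "J \<circ> a2 = d"
      by (simp_all add: J_def a_def d_def K0 K1 c' fun_eq_iff)
    ultimately show "homotopic_paths S (n \<circ> c) (d +++ c +++ reversepath d)"
      by (simp add: path_compose_join path_compose_reversepath)
  qed
qed

section \<open>The surface\<close>

lemma norm_side_point [simp]: "norm (side_point g s) = 1"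
  by (simp add: side_point_def)

text \<open>Gluing happens on the unit circle only; this later shows that no point of the open disc
  is glued to another point.\<close>

lemma side_identified_norm:
  assumes "side_identified g x y"
  shows "norm x = 1"
proof -
  have "\<exists>s. x = side_point g s"
    using assms by (auto simp: side_identified_def doubleton_eq_iff)
  then show ?thesis by auto
qed

text \<open>Sides are needed apart from the edges: in each block of four, sides 0 and 3 are standard
  edges, while sides 1 and 2 run along edges backwards.\<close>

definition side_arc :: "nat \<Rightarrow> real \<Rightarrow> real \<Rightarrow> complex" where
  "side_arc g s = (\<lambda>t. side_point g (s + t))"

lemma side_arc:
  "path (side_arc g s)" "path_image (side_arc g s) \<subseteq> cball 0 1"
  "pathstart (side_arc g s) = side_point g s" "pathfinish (side_arc g s) = side_point g (s + 1)"
proof -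
  show "path (side_arc g s)"
    unfolding path_def side_arc_def side_point_def divide_inverse by (intro continuous_intros)
qed (auto simp: side_arc_def path_image_def pathstart_def pathfinish_def)

locale standard_surface =
  fixes g :: nat and q :: "complex \<Rightarrow> 's::t2_space"
  assumes genus: "g \<ge> 1" and closed_surface: "closed_surface g q"
begin

lemma continuous_q: "continuous_on (cball 0 1) q"
  using closed_surface by (simp add: closed_surface_def)

lemma q_eq_iff:
  "\<lbrakk>x \<in> cball 0 1; y \<in> cball 0 1\<rbrakk> \<Longrightarrow> q x = q y \<longleftrightarrow> x = y \<or> side_identified g x y"
  using closed_surface by (simp add: closed_surface_def)

text \<open>All corners of the polygon are glued together, and corner 0 is the point 1.\<close>

lemma q_side_point: "q (side_point g (real k)) = vertex q"
proof -
  have "side_identified g (side_point g (real k)) (side_point g (real 0))"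
    unfolding side_identified_def by blast
  then show ?thesis
    by (simp add: vertex_def q_eq_iff side_point_def)
qed

lemma first_side_eq: "i \<le> g \<Longrightarrow> first_side g i = real (4 * (g - i))"
  by (simp add: first_side_def of_nat_diff)

lemma q_comp_in_loops:
  assumes "path c" "path_image c \<subseteq> cball 0 1" "q (pathstart c) = vertex q" "q (pathfinish c) = vertex q"
  shows "q \<circ> c \<in> loops_at (surface q) (vertex q)"
proof -
  have "path (q \<circ> c)"
    using assms(1) continuous_on_subset[OF continuous_q assms(2)] by (rule path_continuous_image)
  then show ?thesis
    using assms(2-) by (simp add: loops_at_def surface_def path_image_compose pathstart_compose
        pathfinish_compose image_mono)
qed

lemma q_side_arc_in_loops: "q \<circ> side_arc g (real k) \<in> loops_at (surface q) (vertex q)"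
  using side_arc[of g "real k"] q_side_point[of k] q_side_point[of "Suc k"]
  by (intro q_comp_in_loops) (simp_all add: add.commute)

lemma standard_edge_eq:
  "standard_edge g q (Alpha i) = q \<circ> side_arc g (first_side g i + 3)"
  "standard_edge g q (Beta i) = q \<circ> side_arc g (first_side g i)"
  by (simp_all add: side_arc_def comp_def)

lemma standard_edge_in_loops:
  assumes "e \<in> edges g"
  shows "standard_edge g q e \<in> loops_at (surface q) (vertex q)"
  using assms q_side_arc_in_loops[of "4 * (g - i) + 3" for i] q_side_arc_in_loops[of "4 * (g - i)" for i]
  by (auto simp: edges_def standard_edge_eq first_side_eq simp del: standard_edge.simps of_nat_diff)

lemma opposite_sides:
  assumes "i \<in> {1..g}" "t \<in> {0..1}"
  shows "q (side_arc g (first_side g i + 1) t) = reversepath (standard_edge g q (Alpha i)) t"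
    "q (side_arc g (first_side g i + 2) t) = reversepath (standard_edge g q (Beta i)) t"
proof -
  let ?k = "first_side g i"
  \<comment> \<open>The gluing is written with the parameter of the standard edge. On the opposite
    side that parameter runs backwards, so the gluing is applied with 1 - t.\<close>
  have t: "1 - t \<in> {0..1}" using assms by auto
  have "{side_point g (?k + 1 + t), side_point g (?k + 3 + (1 - t))}
      = {side_point g (?k + 3 + (1 - t)), side_point g (?k + 1 + (1 - (1 - t)))}"
    by (simp add: insert_commute)
  then have "side_identified g (side_point g (?k + 1 + t)) (side_point g (?k + 3 + (1 - t)))"
    using assms(1) t unfolding side_identified_def by blast
  then show "q (side_arc g (?k + 1) t) = reversepath (standard_edge g q (Alpha i)) t"
    unfolding side_arc_def reversepath_def standard_edge.simps by (subst q_eq_iff) simp_all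
  have "{side_point g (?k + 2 + t), side_point g (?k + (1 - t))}
      = {side_point g (?k + (1 - t)), side_point g (?k + 2 + (1 - (1 - t)))}"
    by (simp add: insert_commute)
  then have "side_identified g (side_point g (?k + 2 + t)) (side_point g (?k + (1 - t)))"
    using assms(1) t unfolding side_identified_def by blast
  then show "q (side_arc g (?k + 2) t) = reversepath (standard_edge g q (Beta i)) t"
    unfolding side_arc_def reversepath_def standard_edge.simps by (subst q_eq_iff) simp_all
qed

lemma vertex_in_surface: "vertex q \<in> surface q"
  by (simp add: vertex_def surface_def)

sublocale pi1: group "surface_group q"
  by (rule group_fundamental_group[OF vertex_in_surface])

lemma generator_in_carrier: "e \<in> edges g \<Longrightarrow> generator g q e \<in> carrier (surface_group q)"
  unfolding generator_def by (intro path_class_in_carrier standard_edge_in_loops)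

lemma relator_in_carrier:
  assumes "n \<le> g"
  shows "relator (surface_group q) n (generator g q) \<in> carrier (surface_group q)"
  by (intro pi1.relator_closed generator_in_carrier) (use assms in \<open>auto simp: edges_def\<close>)

text \<open>The path \<open>c\<close> runs along the last \<open>4n\<close> sides of the polygon.\<close>

lemma boundary_path_relator:
  assumes "n \<le> g"
  shows "\<exists>c. path c \<and> path_image c \<subseteq> cball 0 1 \<and> pathstart c = side_point g (first_side g n) \<and>
    pathfinish c = 1 \<and>
    path_class (surface q) (q \<circ> c) = inv\<^bsub>surface_group q\<^esub> (relator (surface_group q) n (generator g q))"
  using assms
proof (induction n)
  case 0
  \<comment> \<open>\<open>first_side g 0\<close> is 4g, a full turn, so the path along no sides is
    constant at 1.\<close>
  have "side_point g (first_side g 0) = 1"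
    using genus by (simp add: side_point_def first_side_def)
  moreover have "path_class (surface q) (q \<circ> (\<lambda>_. 1))
      = inv\<^bsub>surface_group q\<^esub> (relator (surface_group q) 0 (generator g q))"
    unfolding relator.simps pi1.inv_one by (simp add: fundamental_group_one vertex_def comp_def)
  ultimately show ?case
    by (intro exI[of _ "\<lambda>_. 1"]) (simp add: path_def path_image_def pathstart_def pathfinish_def)
next
  case (Suc n)
  let ?S = "surface q" and ?G = "surface_group q" and ?v = "vertex q"
    and ?R = "relator (surface_group q) n (generator g q)"
  obtain c where c: "path c" "path_image c \<subseteq> cball 0 1" "pathstart c = side_point g (first_side g n)"
      "pathfinish c = 1" "path_class ?S (q \<circ> c) = inv\<^bsub>?G\<^esub> ?R"
    using Suc.IH Suc_leD[OF Suc.prems] by metis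
  define k where "k = 4 * (g - Suc n)"
  have k: "first_side g (Suc n) = real k" "first_side g n = real (k + 4)"
    using Suc.prems by (simp_all add: k_def first_side_def of_nat_diff)
  define s where "s = (\<lambda>j. side_arc g (real (k + j)))"
  define P where "P = (\<lambda>j. side_point g (real (k + j)))"
  have s: "path (s j)" "path_image (s j) \<subseteq> cball 0 1" "pathstart (s j) = P j" "pathfinish (s j) = P (Suc j)" for j
    using side_arc[of g "real (k + j)"] by (simp_all add: s_def P_def ac_simps)
  \<comment> \<open>The four new sides start at the corners k to k + 3 and \<open>c\<close> starts
    at k + 4, written \<open>Suc 3\<close> to match the end of \<open>s 3\<close>.\<close>
  have c_start: "pathstart c = P (Suc 3)"
    using c(3) by (simp add: P_def k)
  let ?c = "s 0 +++ s 1 +++ s 2 +++ s 3 +++ c"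
  let ?a = "generator g q (Alpha (Suc n))" and ?b = "generator g q (Beta (Suc n))"
  have e: "Alpha (Suc n) \<in> edges g" "Beta (Suc n) \<in> edges g"
    using Suc.prems by (auto simp: edges_def)
  note gen = generator_in_carrier[OF e(1)] generator_in_carrier[OF e(2)]
  have R: "?R \<in> carrier ?G" using Suc.prems by (simp add: relator_in_carrier)
  have loops: "q \<circ> s j \<in> loops_at ?S ?v" for j unfolding s_def by (rule q_side_arc_in_loops)
  have loop_c: "q \<circ> c \<in> loops_at ?S ?v"
    using c q_side_point[of "k + 4"] by (intro q_comp_in_loops) (simp_all only: k vertex_def)
  have a: "path_class ?S (q \<circ> s 3) = ?a" and b: "path_class ?S (q \<circ> s 0) = ?b"
    by (simp_all add: generator_def standard_edge_eq k s_def del: standard_edge.simps)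
  have a': "path_class ?S (q \<circ> s 1) = inv\<^bsub>?G\<^esub> ?a"
    unfolding generator_def fundamental_group_inv[OF standard_edge_in_loops[OF e(1)]]
    by (intro path_class_cong[OF loops])
      (use opposite_sides(1)[of "Suc n"] Suc.prems in \<open>simp add: k s_def add.commute\<close>)
  have b': "path_class ?S (q \<circ> s 2) = inv\<^bsub>?G\<^esub> ?b"
    unfolding generator_def fundamental_group_inv[OF standard_edge_in_loops[OF e(2)]]
    by (intro path_class_cong[OF loops])
      (use opposite_sides(2)[of "Suc n"] Suc.prems in \<open>simp add: k s_def add.commute\<close>)
  \<comment> \<open>The right-to-left product reverses the order in which the sides are
    traversed.\<close>
  have "path_class ?S (q \<circ> ?c) = path_class ?S (q \<circ> c) \<otimes>\<^bsub>?G\<^esub> path_class ?S (q \<circ> s 3)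
      \<otimes>\<^bsub>?G\<^esub> path_class ?S (q \<circ> s 2) \<otimes>\<^bsub>?G\<^esub> path_class ?S (q \<circ> s 1) \<otimes>\<^bsub>?G\<^esub> path_class ?S (q \<circ> s 0)"
    by (simp only: path_compose_join fundamental_group_mult loops loop_c loops_at_join)
  also have "\<dots> = inv\<^bsub>?G\<^esub> ?R \<otimes>\<^bsub>?G\<^esub> ?a \<otimes>\<^bsub>?G\<^esub> inv\<^bsub>?G\<^esub> ?b \<otimes>\<^bsub>?G\<^esub> inv\<^bsub>?G\<^esub> ?a \<otimes>\<^bsub>?G\<^esub> ?b"
    by (simp only: a b a' b' c(5))
  \<comment> \<open>The inverse of [b^-1, a] R is R^-1 a b^-1 a^-1 b: the counterclockwise boundary
    reads the inverse of the relator.\<close>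
  also have "\<dots> = inv\<^bsub>?G\<^esub> (relator ?G (Suc n) (generator g q))"
    using gen R by (simp add: commutator_def pi1.inv_mult_group pi1.m_assoc)
  finally have "path_class ?S (q \<circ> ?c) = inv\<^bsub>?G\<^esub> (relator ?G (Suc n) (generator g q))" .
  moreover have "path ?c"
    using c(1) by (intro path_join_imp) (simp_all add: s c_start numeral_2_eq_2 numeral_3_eq_3)
  moreover have "path_image ?c \<subseteq> cball 0 1"
    by (intro subset_path_image_join s(2) c(2))
  moreover have "pathstart ?c = side_point g (first_side g (Suc n))" "pathfinish ?c = 1"
    using c(4) by (simp_all add: s P_def k)
  ultimately show ?case by blast
qed

text \<open>For n = g the boundary path starts at corner 0 and ends at 1, which are the same point.
  It is a loop in the closed disc, so its image under \<open>q\<close> is contractible.\<close>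

lemma relator_generator: "relator (surface_group q) g (generator g q) = \<one>\<^bsub>surface_group q\<^esub>"
proof -
  let ?R = "relator (surface_group q) g (generator g q)"
  obtain c where c: "path c" "path_image c \<subseteq> cball 0 1" "pathstart c = side_point g (first_side g g)"
      "pathfinish c = 1" "path_class (surface q) (q \<circ> c) = inv\<^bsub>surface_group q\<^esub> ?R"
    using boundary_path_relator[of g] by auto
  have "homotopic_paths (surface q) (q \<circ> c) (q \<circ> (\<lambda>_. 1))"
    using c by (intro homotopic_paths_image_convex[OF convex_cball continuous_q])
      (auto simp: surface_def first_side_def side_point_def path_def path_image_def pathstart_def pathfinish_def)
  then have "inv\<^bsub>surface_group q\<^esub> ?R = \<one>\<^bsub>surface_group q\<^esub>"
    using path_class_eqI c(5) by (fastforce simp: fundamental_group_one vertex_def comp_def)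
  then show ?thesis
    using relator_in_carrier[of g] by (metis le_refl pi1.inv_inv pi1.inv_one)
qed

end

section \<open>Groups of homeomorphisms\<close>

text \<open>A common form of two cases, with \<open>C\<close> empty for the closed surface and
  \<open>C\<close> the boundary circle for the punctured one, so that group axioms and normality are
  proved once. Orientation is treated separately.\<close>

definition homeos_fixing :: "'s::topological_space set \<Rightarrow> 's set \<Rightarrow> ('s \<Rightarrow> 's) monoid" where
  "homeos_fixing T C =
     \<lparr>carrier = {f \<in> extensional T. (\<exists>f'. homeomorphism T T f f') \<and> (\<forall>x\<in>C. f x = x)},
      monoid.mult = compose T,
      one = (\<lambda>x\<in>T. x)\<rparr>"

definition null_homotopic_fixing :: "'s::topological_space set \<Rightarrow> 's set \<Rightarrow> ('s \<Rightarrow> 's) set" where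
  "null_homotopic_fixing T C = {f \<in> carrier (homeos_fixing T C).
     homotopic_with_canon (\<lambda>h. \<forall>x\<in>C. h x = x) T T f id}"

lemma homeomorphism_cong:
  assumes "homeomorphism S T f g" "\<And>x. x \<in> S \<Longrightarrow> f' x = f x" "\<And>y. y \<in> T \<Longrightarrow> g' y = g y"
  shows "homeomorphism S T f' g'"
proof -
  have "f' ` S = f ` S" "g' ` T = g ` T" using assms by auto
  moreover have "continuous_on S f'" "continuous_on T g'"
    using assms continuous_on_cong[of S S f' f] continuous_on_cong[of T T g' g]
    by (auto simp: homeomorphism_def)
  ultimately show ?thesis using assms by (auto simp: homeomorphism_def)
qed

lemma homeos_fixing_mem:
  assumes "f \<in> carrier (homeos_fixing T C)"
  shows "f \<in> extensional T" "f ` T = T" "continuous_on T f" "\<And>x. x \<in> C \<Longrightarrow> f x = x"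
    "\<And>x. x \<in> T \<Longrightarrow> f x \<in> T"
  using assms by (auto simp: homeos_fixing_def homeomorphism_def)

lemma homeos_fixing_inv:
  assumes "C \<subseteq> T" "f \<in> carrier (homeos_fixing T C)"
  obtains f' where "f' \<in> carrier (homeos_fixing T C)" "\<And>x. x \<in> T \<Longrightarrow> f' (f x) = x"
proof -
  obtain f' where f': "homeomorphism T T f f'" using assms by (auto simp: homeos_fixing_def)
  have inv: "homeomorphism T T (restrict f' T) f"
    by (rule homeomorphism_cong[OF homeomorphism_symD[OF f']]) auto
  have fixed: "f' x = x" if "x \<in> C" for x
    using homeomorphism_apply1[OF f', of x] homeos_fixing_mem(4)[OF assms(2) that] that assms(1) by auto
  show ?thesis
  proof (rule that[of "restrict f' T"])
    show "restrict f' T \<in> carrier (homeos_fixing T C)"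
      using inv fixed assms(1) by (auto simp: homeos_fixing_def)
    show "restrict f' T (f x) = x" if "x \<in> T" for x
      using that f' homeos_fixing_mem(5)[OF assms(2) that] by (simp add: homeomorphism_apply1)
  qed
qed

lemma group_homeos_fixing:
  assumes "C \<subseteq> T"
  shows "group (homeos_fixing T C)"
proof (rule groupI)
  fix f g assume f: "f \<in> carrier (homeos_fixing T C)" and g: "g \<in> carrier (homeos_fixing T C)"
  obtain f' g' where "homeomorphism T T f f'" "homeomorphism T T g g'"
    using f g by (auto simp: homeos_fixing_def)
  then have "homeomorphism T T (f \<circ> g) (g' \<circ> f')"
    using homeomorphism_compose by blast
  then have "homeomorphism T T (compose T f g) (g' \<circ> f')"
    by (rule homeomorphism_cong) (auto simp: compose_def)
  then show "f \<otimes>\<^bsub>homeos_fixing T C\<^esub> g \<in> carrier (homeos_fixing T C)"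
    using homeos_fixing_mem[OF f] homeos_fixing_mem[OF g] assms
    by (auto simp: homeos_fixing_def compose_def)
  fix h assume h: "h \<in> carrier (homeos_fixing T C)"
  show "f \<otimes>\<^bsub>homeos_fixing T C\<^esub> g \<otimes>\<^bsub>homeos_fixing T C\<^esub> h
      = f \<otimes>\<^bsub>homeos_fixing T C\<^esub> (g \<otimes>\<^bsub>homeos_fixing T C\<^esub> h)"
    using homeos_fixing_mem[OF h] by (auto simp: homeos_fixing_def compose_def)
next
  have "homeomorphism T T (\<lambda>x\<in>T. x) id"
    by (rule homeomorphism_cong[of T T id id]) (auto simp: homeomorphism_def)
  then show "\<one>\<^bsub>homeos_fixing T C\<^esub> \<in> carrier (homeos_fixing T C)"
    using assms by (auto simp: homeos_fixing_def)
next
  fix f assume f: "f \<in> carrier (homeos_fixing T C)"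
  show "\<one>\<^bsub>homeos_fixing T C\<^esub> \<otimes>\<^bsub>homeos_fixing T C\<^esub> f = f"
    using homeos_fixing_mem[OF f]
    by (auto simp: homeos_fixing_def compose_def fun_eq_iff extensional_def)
  obtain f' where "f' \<in> carrier (homeos_fixing T C)" "\<And>x. x \<in> T \<Longrightarrow> f' (f x) = x"
    using homeos_fixing_inv[OF assms f] by metis
  then show "\<exists>f'\<in>carrier (homeos_fixing T C). f' \<otimes>\<^bsub>homeos_fixing T C\<^esub> f = \<one>\<^bsub>homeos_fixing T C\<^esub>"
    by (intro bexI[of _ f']) (auto simp: homeos_fixing_def compose_def)
qed

lemma homeos_fixing_mult: "x \<in> T \<Longrightarrow> (f \<otimes>\<^bsub>homeos_fixing T C\<^esub> f') x = f (f' x)"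
  by (simp add: homeos_fixing_def compose_def)

lemma homeos_fixing_one: "x \<in> T \<Longrightarrow> \<one>\<^bsub>homeos_fixing T C\<^esub> x = x"
  by (simp add: homeos_fixing_def)

lemma homeos_fixing_inv_apply:
  assumes "C \<subseteq> T" "f \<in> carrier (homeos_fixing T C)" "x \<in> T"
  shows "f ((inv\<^bsub>homeos_fixing T C\<^esub> f) x) = x" "(inv\<^bsub>homeos_fixing T C\<^esub> f) (f x) = x"
proof -
  interpret group "homeos_fixing T C" by (rule group_homeos_fixing[OF assms(1)])
  show "f ((inv\<^bsub>homeos_fixing T C\<^esub> f) x) = x"
    using homeos_fixing_mult[OF assms(3)] r_inv[OF assms(2)] homeos_fixing_one[OF assms(3)] by metis
  show "(inv\<^bsub>homeos_fixing T C\<^esub> f) (f x) = x"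
    using homeos_fixing_mult[OF assms(3)] l_inv[OF assms(2)] homeos_fixing_one[OF assms(3)] by metis
qed

text \<open>The homotopy from \<open>f\<close> to the identity is composed with \<open>k\<close> on
  the left and \<open>l\<close> on the right. The resulting maps are specified only on
  \<open>T\<close>, because products in the group are restricted to \<open>T\<close>.\<close>

lemma homotopic_fixing_compose:
  assumes "homotopic_with_canon (\<lambda>h. \<forall>x\<in>C. h x = x) T T f id" "C \<subseteq> T"
    and "continuous_on T k" "k ` T \<subseteq> T" "continuous_on T l" "l ` T \<subseteq> T"
    and "\<And>x. x \<in> C \<Longrightarrow> k x = x" "\<And>x. x \<in> C \<Longrightarrow> l x = x"
    and "\<And>x. x \<in> T \<Longrightarrow> f' x = k (f (l x))" "\<And>x. x \<in> T \<Longrightarrow> e x = k (l x)"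
  shows "homotopic_with_canon (\<lambda>h. \<forall>x\<in>C. h x = x) T T f' e"
proof -
  let ?P = "\<lambda>h. \<forall>x\<in>C. h x = x"
  have "homotopic_with_canon ?P T T (k \<circ> f) (k \<circ> id)"
    by (rule homotopic_with_compose_continuous_map_left[OF assms(1)])
      (use assms(3,4,7) in \<open>simp_all add: image_subset_iff_funcset\<close>)
  then have "homotopic_with_canon ?P T T ((k \<circ> f) \<circ> l) ((k \<circ> id) \<circ> l)"
    by (rule homotopic_with_compose_continuous_map_right)
      (use assms(5,6,8) in \<open>simp_all add: image_subset_iff_funcset\<close>)
  then have hom: "homotopic_with_canon ?P T T (\<lambda>x. k (f (l x))) (\<lambda>x. k (l x))"
    by (simp add: comp_def)
  note cont = homotopic_with_imp_continuous_maps[OF hom] and fixed = homotopic_with_imp_property[OF hom]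
  have "\<forall>x\<in>C. f' x = x" "\<forall>x\<in>C. e x = x"
    using fixed subsetD[OF assms(2)] assms(9,10) by metis+
  then have "homotopic_with_canon ?P T T (\<lambda>x. k (f (l x))) f'"
      "homotopic_with_canon ?P T T (\<lambda>x. k (l x)) e"
    using cont fixed assms(9,10) by (auto intro!: homotopic_with_equal)
  then show ?thesis
    using homotopic_with_trans[OF homotopic_with_symD homotopic_with_trans[OF hom]] by blast
qed

text \<open>Inverses, products and conjugates all come from composing one homotopy from
  \<open>f\<close> to the identity: with the inverse of \<open>f\<close> on the right, with
  \<open>g\<close> on the right, or with \<open>k\<close> on the left and its inverse on the
  right.\<close>

lemma normal_null_homotopic_fixing:
  assumes "C \<subseteq> T"
  shows "null_homotopic_fixing T C \<lhd> homeos_fixing T C"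
proof -
  let ?G = "homeos_fixing T C" and ?N = "null_homotopic_fixing T C" and ?P = "\<lambda>h. \<forall>x\<in>C. h x = x"
  interpret group ?G by (rule group_homeos_fixing[OF assms])
  note mem = homeos_fixing_mem[of _ T C]
  note mult = homeos_fixing_mult[where T = T and C = C]
  note inv_r = homeos_fixing_inv_apply[OF assms]
  have sub: "f \<in> carrier ?G" "homotopic_with_canon ?P T T f id" if "f \<in> ?N" for f
    using that by (auto simp: null_homotopic_fixing_def)
  have NI: "f \<in> ?N" if "f \<in> carrier ?G" "homotopic_with_canon ?P T T f id" for f
    using that by (simp add: null_homotopic_fixing_def)
  show ?thesis
    unfolding normal_inv_iff
  proof (intro conjI ballI)
    show "subgroup ?N ?G"
    proof
      show "?N \<subseteq> carrier ?G" using sub by blast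
      show "\<one>\<^bsub>?G\<^esub> \<in> ?N"
        using assms mem[OF one_closed] homeos_fixing_one[of _ T C]
        by (intro NI one_closed homotopic_with_equal) (auto simp: subset_iff)
      fix f assume f: "f \<in> ?N"
      note f' = sub(1)[OF f] and F = inv_closed[OF sub(1)[OF f]]
      have "homotopic_with_canon ?P T T id (inv\<^bsub>?G\<^esub> f)"
        by (rule homotopic_fixing_compose[OF sub(2)[OF f] assms, of id "inv\<^bsub>?G\<^esub> f"])
          (use mem[OF F] inv_r[OF f'] in auto)
      then show "inv\<^bsub>?G\<^esub> f \<in> ?N"
        using F by (intro NI) (auto intro: homotopic_with_symD)
      fix g assume g: "g \<in> ?N"
      have "homotopic_with_canon ?P T T (f \<otimes>\<^bsub>?G\<^esub> g) g"
        by (rule homotopic_fixing_compose[OF sub(2)[OF f] assms, of id g])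
          (use mem[OF sub(1)[OF g]] mult in auto)
      then show "f \<otimes>\<^bsub>?G\<^esub> g \<in> ?N"
        using sub[OF f] sub[OF g] by (intro NI m_closed) (auto intro: homotopic_with_trans)
    qed
    fix k f assume k: "k \<in> carrier ?G" and f: "f \<in> ?N"
    note K = inv_closed[OF k]
    have "homotopic_with_canon ?P T T (k \<otimes>\<^bsub>?G\<^esub> f \<otimes>\<^bsub>?G\<^esub> inv\<^bsub>?G\<^esub> k) id"
      by (rule homotopic_fixing_compose[OF sub(2)[OF f] assms, of k "inv\<^bsub>?G\<^esub> k"])
        (use mem[OF K] mem[OF k] mult inv_r[OF k] in auto)
    then show "k \<otimes>\<^bsub>?G\<^esub> f \<otimes>\<^bsub>?G\<^esub> inv\<^bsub>?G\<^esub> k \<in> ?N"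
      using k sub(1)[OF f] by (intro NI m_closed inv_closed)
  qed
qed

lemma orientation_preserving_homotopic_id:
  assumes "homotopic_with_canon (\<lambda>_. True) S S f id"
  shows "orientation_preserving S f"
  unfolding orientation_preserving_def using homology_homotopy_empty[OF assms] by (simp add: hom_induced_id)

lemma punctured_homeos_eq: "punctured_homeos q = homeos_fixing (punctured_surface q) (disc_boundary q)"
  by (simp add: punctured_homeos_def homeos_fixing_def Let_def)

lemma null_homotopic_punctured_homeos_eq:
  "null_homotopic_punctured_homeos q = null_homotopic_fixing (punctured_surface q) (disc_boundary q)"
  by (simp add: null_homotopic_punctured_homeos_def null_homotopic_fixing_def punctured_homeos_eq)

text \<open>Maps homotopic to the identity preserve the orientation by homotopy invariance of
  homology. Hence cosets may be computed in the group of all homeomorphisms.\<close>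

lemma null_homotopic_homeos_eq: "null_homotopic_homeos q = null_homotopic_fixing (surface q) {}"
proof -
  have "f \<in> carrier (surface_homeos q) \<longleftrightarrow>
      f \<in> carrier (homeos_fixing (surface q) {}) \<and> orientation_preserving (surface q) f" for f
    by (auto simp: surface_homeos_def homeos_fixing_def Let_def)
  then show ?thesis
    using orientation_preserving_homotopic_id[of "surface q"]
    by (auto simp: null_homotopic_homeos_def null_homotopic_fixing_def)
qed

lemma r_coset_surface_homeos:
  "N #>\<^bsub>surface_homeos q\<^esub> f = N #>\<^bsub>homeos_fixing (surface q) {}\<^esub> f"
  by (simp add: r_coset_def surface_homeos_def homeos_fixing_def Let_def)

section \<open>Extending homeomorphisms over the removed disc\<close>

context standard_surface
begin

lemma q_eq_interior:
  assumes "q x = q y" "x \<in> cball 0 1" "y \<in> ball 0 1"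
  shows "x = y"
  using assms q_eq_iff[of y x] side_identified_norm[of g y x] by auto

text \<open>Points of the small disc are glued to no other point, so removing their images leaves
  the image of the annulus.\<close>

lemma punctured_surface_eq: "punctured_surface q = q ` (cball 0 1 - ball 0 (1/2))"
proof -
  have "q x \<in> removed_disc q \<longleftrightarrow> x \<in> ball 0 (1/2)" if x: "x \<in> cball 0 1" for x
  proof
    assume "q x \<in> removed_disc q"
    then obtain y where y: "q x = q y" "y \<in> ball 0 (1/2)" by (auto simp: removed_disc_def)
    then have "x = y" using x by (intro q_eq_interior) auto
    with y show "x \<in> ball 0 (1/2)" by simp
  qed (simp add: removed_disc_def)
  then show ?thesis
    unfolding punctured_surface_def surface_def by blast
qed

lemma surface_eq_Un: "surface q = q ` cball 0 (1/2) \<union> punctured_surface q"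
proof -
  have "cball 0 1 = cball 0 (1/2) \<union> (cball 0 1 - ball 0 (1/2) :: complex set)" by auto
  then show ?thesis
    unfolding punctured_surface_eq surface_def by (metis image_Un)
qed

text \<open>Both pieces are continuous images of compact sets in a Hausdorff space. Closedness is
  what pasting along the boundary circle requires.\<close>

lemma closed_pieces: "closed (q ` cball 0 (1/2))" "closed (punctured_surface q)"
  unfolding punctured_surface_eq
  by (intro compact_imp_closed compact_continuous_image continuous_on_subset[OF continuous_q]
      compact_diff compact_cball open_ball; auto)+

lemma disc_boundary_subset: "disc_boundary q \<subseteq> punctured_surface q"
  unfolding disc_boundary_def punctured_surface_eq by (intro image_mono) auto

lemma disc_diff_removed: "q ` cball 0 (1/2) - removed_disc q \<subseteq> disc_boundary q"
  unfolding removed_disc_def disc_boundary_def cball_diff_eq_sphere[symmetric] by (rule image_diff_subset)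

abbreviation punctured_group where
  "punctured_group \<equiv> homeos_fixing (punctured_surface q) (disc_boundary q)"

abbreviation surface_homeo_group where
  "surface_homeo_group \<equiv> homeos_fixing (surface q) {}"

text \<open>Pasting over a closed cover in two pieces. The parameter set \<open>U\<close> lets the
  same statement serve single maps and homotopies.\<close>

lemma continuous_on_extend:
  assumes "closed U" "continuous_on (U \<times> punctured_surface q) k"
    and "\<And>t x. \<lbrakk>t \<in> U; x \<in> disc_boundary q\<rbrakk> \<Longrightarrow> k (t, x) = x"
  shows "continuous_on (U \<times> surface q) (\<lambda>y. if snd y \<in> removed_disc q then snd y else k y)"
  unfolding surface_eq_Un Sigma_Un_distrib2
proof (rule continuous_on_cases)
  show "\<forall>y. y \<in> U \<times> q ` cball 0 (1/2) \<and> snd y \<notin> removed_disc q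
      \<or> y \<in> U \<times> punctured_surface q \<and> snd y \<in> removed_disc q \<longrightarrow> snd y = k y"
    using disc_diff_removed assms(3) by (auto simp: punctured_surface_def)
qed (use assms closed_pieces in \<open>auto intro!: closed_Times continuous_intros\<close>)

lemma extend_by_id_apply:
  "x \<in> surface q \<Longrightarrow> extend_by_id q f x = (if x \<in> removed_disc q then x else f x)"
  by (simp add: extend_by_id_def)

lemma extend_by_id_closed:
  assumes "f \<in> carrier punctured_group" "x \<in> surface q"
  shows "extend_by_id q f x \<in> surface q"
  using assms homeos_fixing_mem(5)[OF assms(1), of x]
  by (auto simp: extend_by_id_apply punctured_surface_def)

lemma extend_by_id_mult:
  assumes "f \<in> carrier punctured_group" "f' \<in> carrier punctured_group"
  shows "extend_by_id q (f \<otimes>\<^bsub>punctured_group\<^esub> f')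
    = extend_by_id q f \<otimes>\<^bsub>surface_homeo_group\<^esub> extend_by_id q f'" (is "?l = ?r")
proof
  fix x
  show "?l x = ?r x"
  proof (cases "x \<in> surface q")
    case x: True
    show ?thesis
    proof (cases "x \<in> removed_disc q")
      case True
      then show ?thesis using x by (simp add: homeos_fixing_mult extend_by_id_apply)
    next
      case False
      with x have "x \<in> punctured_surface q" by (simp add: punctured_surface_def)
      with homeos_fixing_mem(5)[OF assms(2) this] x False show ?thesis
        by (simp add: homeos_fixing_mult extend_by_id_apply punctured_surface_def)
    qed
  qed (simp add: extend_by_id_def homeos_fixing_def compose_def)
qed

lemma continuous_on_extend_by_id:
  assumes "f \<in> carrier punctured_group"
  shows "continuous_on (surface q) (extend_by_id q f)"
proof -
  \<comment> \<open>A single map is treated as a family over the one-point parameter set.\<close>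
  have "continuous_on ({0::real} \<times> surface q)
      (\<lambda>y. if snd y \<in> removed_disc q then snd y else (f \<circ> snd) y)"
    using homeos_fixing_mem(4)[OF assms]
    by (intro continuous_on_extend continuous_on_compose continuous_intros)
      (auto intro: continuous_on_subset[OF homeos_fixing_mem(3)[OF assms]])
  then have "continuous_on (surface q) 
      ((\<lambda>y. if snd y \<in> removed_disc q then snd y else (f \<circ> snd) y) \<circ> Pair (0::real))"
    by (intro continuous_on_compose continuous_intros) (auto elim: continuous_on_subset)
  then show ?thesis
    by (rule continuous_on_eq) (simp add: extend_by_id_apply)
qed

text \<open>Extension is multiplicative, so the extension of the inverse is inverse to the
  extension.\<close>

lemma extend_by_id_in_carrier:
  assumes f: "f \<in> carrier punctured_group"
  shows "extend_by_id q f \<in> carrier surface_homeo_group"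
proof -
  interpret group punctured_group by (rule group_homeos_fixing[OF disc_boundary_subset])
  let ?f' = "inv\<^bsub>punctured_group\<^esub> f"
  have one: "extend_by_id q \<one>\<^bsub>punctured_group\<^esub> x = x" if "x \<in> surface q" for x
    using that by (simp add: extend_by_id_apply homeos_fixing_one punctured_surface_def)
  have cancel: "extend_by_id q k (extend_by_id q k' x) = x"
    if "k \<in> carrier punctured_group" "k' \<in> carrier punctured_group"
      "k \<otimes>\<^bsub>punctured_group\<^esub> k' = \<one>\<^bsub>punctured_group\<^esub>" "x \<in> surface q" for k k' x
    using extend_by_id_mult[OF that(1,2)] homeos_fixing_mult[OF that(4)] one[OF that(4)] that(3) by metis
  have "homeomorphism (surface q) (surface q) (extend_by_id q f) (extend_by_id q ?f')"
    using f extend_by_id_closed cancel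
    by (intro homeomorphismI continuous_on_extend_by_id) (auto simp: image_subset_iff)
  then show ?thesis
    by (auto simp: homeos_fixing_def extend_by_id_def)
qed

text \<open>Every stage of the homotopy fixes the boundary circle and is therefore continued by the
  identity of the disc.\<close>

lemma extend_by_id_null_homotopic:
  assumes "f \<in> null_homotopic_fixing (punctured_surface q) (disc_boundary q)"
  shows "extend_by_id q f \<in> null_homotopic_fixing (surface q) {}"
proof -
  let ?T = "punctured_surface q"
  have f: "f \<in> carrier punctured_group"
    and "homotopic_with_canon (\<lambda>h. \<forall>x\<in>disc_boundary q. h x = x) ?T ?T f id"
    using assms by (auto simp: null_homotopic_fixing_def)
  then obtain k :: "real \<times> 's \<Rightarrow> 's" where k: "continuous_on ({0..1} \<times> ?T) k" "k \<in> {0..1} \<times> ?T \<rightarrow> ?T"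
    and k01: "\<And>x. k (0, x) = f x" "\<And>x. k (1, x) = x"
    and fixed: "\<And>t x. \<lbrakk>t \<in> {0..1}; x \<in> disc_boundary q\<rbrakk> \<Longrightarrow> k (t, x) = x"
    by (auto simp: homotopic_with_def)
  have "homotopic_with_canon (\<lambda>h. \<forall>x\<in>{}. h x = x) (surface q) (surface q) (extend_by_id q f) id"
  proof (subst homotopic_with, simp, intro exI conjI)
    let ?k = "\<lambda>y. if snd y \<in> removed_disc q then snd y else k y"
    have "continuous_on ({0..1} \<times> surface q) ?k"
      by (intro continuous_on_extend k fixed) auto
    moreover have "?k \<in> {0..1} \<times> surface q \<rightarrow> surface q"
      using k(2) by (fastforce simp: punctured_surface_def)
    ultimately show "continuous_map (prod_topology (top_of_set {0..1}) (top_of_set (surface q)))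
        (top_of_set (surface q)) ?k"
      by (simp add: subtopology_Times[symmetric])
  qed (simp_all add: k01 extend_by_id_apply)
  with extend_by_id_in_carrier[OF f] show ?thesis
    by (simp add: null_homotopic_fixing_def)
qed

text \<open>\<open>cap_off\<close> takes the only element of a set of cosets. There is only one:
  replacing \<open>k\<close> by \<open>n\<close> after \<open>k\<close> multiplies the extension by
  that of \<open>n\<close>, which lies in the null-homotopic subgroup.\<close>

lemma cap_off_coset:
  assumes k: "k \<in> carrier punctured_group"
  shows "cap_off q (null_homotopic_punctured_homeos q #>\<^bsub>punctured_homeos q\<^esub> k)
    = null_homotopic_homeos q #>\<^bsub>surface_homeo_group\<^esub> extend_by_id q k"
proof -
  let ?N' = "null_homotopic_fixing (punctured_surface q) (disc_boundary q)"
  let ?N = "null_homotopic_fixing (surface q) {}"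
  interpret P: normal ?N' punctured_group by (rule normal_null_homotopic_fixing[OF disc_boundary_subset])
  interpret S: normal ?N surface_homeo_group by (rule normal_null_homotopic_fixing) simp
  have "?N #>\<^bsub>surface_homeo_group\<^esub> extend_by_id q f = ?N #>\<^bsub>surface_homeo_group\<^esub> extend_by_id q k"
    if f: "f \<in> ?N' #>\<^bsub>punctured_group\<^esub> k" for f
  proof -
    obtain n where n: "n \<in> ?N'" "f = n \<otimes>\<^bsub>punctured_group\<^esub> k"
      using f by (auto simp: r_coset_def)
    note N = extend_by_id_null_homotopic[OF n(1)] P.mem_carrier[OF n(1)]
    have "?N #>\<^bsub>surface_homeo_group\<^esub> extend_by_id q f
        = (?N #>\<^bsub>surface_homeo_group\<^esub> extend_by_id q n) #>\<^bsub>surface_homeo_group\<^esub> extend_by_id q k"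
      using extend_by_id_mult[OF N(2) k]
        S.coset_mult_assoc[OF S.subset S.mem_carrier[OF N(1)] extend_by_id_in_carrier[OF k]]
      by (simp only: n(2))
    then show ?thesis
      using S.coset_join2[OF S.mem_carrier[OF N(1)] S.subgroup_axioms N(1)] by simp
  qed
  moreover have "k \<in> ?N' #>\<^bsub>punctured_group\<^esub> k"
    by (rule P.rcos_self[OF k P.subgroup_axioms])
  ultimately have "(\<lambda>f. ?N #>\<^bsub>surface_homeo_group\<^esub> extend_by_id q f) ` (?N' #>\<^bsub>punctured_group\<^esub> k)
      = {?N #>\<^bsub>surface_homeo_group\<^esub> extend_by_id q k}"
    by blast
  then show ?thesis
    by (simp add: cap_off_def null_homotopic_punctured_homeos_eq punctured_homeos_eq null_homotopic_homeos_eq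
        r_coset_surface_homeos)
qed

text \<open>The inverse of a coset is the coset of the inverse, so \<open>h\<close> is some
  null-homotopic \<open>n\<close> after the extension of the inverse of \<open>f\<close>; composing
  with the extension of \<open>f\<close> cancels. This is how the inverse in \<open>realises\<close>
  enters.\<close>

lemma cap_off_inv_coset:
  assumes f: "f \<in> carrier punctured_group"
    and h: "h \<in> cap_off q (inv\<^bsub>punctured_mapping_class_group q\<^esub>
      (null_homotopic_punctured_homeos q #>\<^bsub>punctured_homeos q\<^esub> f))"
  obtains n where "homotopic_with_canon (\<lambda>_. True) (surface q) (surface q) n id"
    "\<And>x. x \<in> surface q \<Longrightarrow> h (extend_by_id q f x) = n x"
proof -
  let ?N' = "null_homotopic_fixing (punctured_surface q) (disc_boundary q)"
  let ?N = "null_homotopic_fixing (surface q) {}"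
  interpret P: normal ?N' punctured_group by (rule normal_null_homotopic_fixing[OF disc_boundary_subset])
  let ?f' = "inv\<^bsub>punctured_group\<^esub> f"
  have "?N' #>\<^bsub>punctured_group\<^esub> f \<in> carrier (punctured_group Mod ?N')"
    using P.rcosetsI[OF P.subset f] by (simp add: FactGroup_def)
  then have "inv\<^bsub>punctured_group Mod ?N'\<^esub> (?N' #>\<^bsub>punctured_group\<^esub> f) = ?N' #>\<^bsub>punctured_group\<^esub> ?f'"
    using P.inv_FactGroup P.rcos_inv[OF f] by simp
  then have "h \<in> ?N #>\<^bsub>surface_homeo_group\<^esub> extend_by_id q ?f'"
    using h cap_off_coset[OF P.inv_closed[OF f]]
    by (simp add: punctured_mapping_class_group_def null_homotopic_punctured_homeos_eq punctured_homeos_eq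
        null_homotopic_homeos_eq)
  then obtain n where n: "n \<in> ?N" "h = n \<otimes>\<^bsub>surface_homeo_group\<^esub> extend_by_id q ?f'"
    by (auto simp: r_coset_def)
  have "h (extend_by_id q f x) = n x" if x: "x \<in> surface q" for x
  proof -
    have "extend_by_id q ?f' (extend_by_id q f x) = extend_by_id q \<one>\<^bsub>punctured_group\<^esub> x"
      using extend_by_id_mult[OF P.inv_closed[OF f] f] homeos_fixing_mult[OF x] P.l_inv[OF f] by metis
    then show ?thesis
      using x extend_by_id_closed[OF f x]
      by (simp add: n(2) homeos_fixing_mult extend_by_id_apply homeos_fixing_one punctured_surface_def)
  qed
  with n(1) show ?thesis
    by (intro that[of n]) (auto simp: null_homotopic_fixing_def)
qed

end

section \<open>Edge slides\<close>

text \<open>The graphs avoid the disc, but classes are taken in the closed surface, where \<tau> is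
  defined. For the standard graph this is the tuple behind \<open>represented_arrow\<close>.\<close>

definition graph_values ::
  "nat \<Rightarrow> (complex \<Rightarrow> 's::t2_space) \<Rightarrow> ((real \<Rightarrow> 's) set \<Rightarrow> 'x) \<Rightarrow> (edge \<Rightarrow> real \<Rightarrow> 's) \<Rightarrow> edge \<Rightarrow> 'x" where
  "graph_values g q \<tau> \<gamma> = (\<lambda>e\<in>edges g. \<tau> (path_class (surface q) (\<gamma> e)))"

lemma embedded_graph_in_loops:
  assumes "embedded_graph g q \<gamma>" "e \<in> edges g"
  shows "\<gamma> e \<in> loops_at (surface q) (vertex q)"
  using assms by (auto simp: embedded_graph_def loops_at_def simple_path_def punctured_surface_def)

lemma oriented_path_in_loops:
  assumes "embedded_graph g q \<gamma>" "fst a \<in> edges g"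
  shows "oriented_path \<gamma> a \<in> loops_at (surface q) (vertex q)"
  using embedded_graph_in_loops[OF assms] by (simp add: oriented_path_def loops_at_reversepath)

text \<open>In the triangle the segment from 0 to \<open>\<i>\<close> is homotopic to the broken
  line through 1, which follows \<open>b\<close> and then \<open>a\<close>. Reading products from
  right to left puts the class of \<open>a\<close> in front.\<close>

lemma graph_slide_path_class:
  assumes "graph_slide g q a b \<gamma> \<gamma>'" "fst a \<in> edges g" "fst b \<in> edges g"
  shows "path_class (surface q) (oriented_path \<gamma>' b) =
    path_class (surface q) (oriented_path \<gamma> a) \<otimes>\<^bsub>surface_group q\<^esub> path_class (surface q) (oriented_path \<gamma> b)"
proof -
  let ?S = "surface q" and ?D = "convex hull {0, 1, \<i>}"
  obtain T where T: "continuous_on ?D T" "T ` ?D \<subseteq> punctured_surface q"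
    and edges: "\<forall>t\<in>{0..1}. T (linepath 0 1 t) = oriented_path \<gamma> b t \<and>
      T (linepath 1 \<i> t) = oriented_path \<gamma> a t \<and> T (linepath 0 \<i> t) = oriented_path \<gamma>' b t"
    using assms(1) unfolding graph_slide_def Let_def by blast
  have emb: "embedded_graph g q \<gamma>" "embedded_graph g q \<gamma>'"
    using assms(1) by (auto simp: graph_slide_def)
  note loops = oriented_path_in_loops[OF emb(1) assms(2)] oriented_path_in_loops[OF emb(1) assms(3)]
    oriented_path_in_loops[OF emb(2) assms(3)]
  have segment: "path_image (linepath x y) \<subseteq> ?D" if "x \<in> {0, 1, \<i>}" "y \<in> {0, 1, \<i>}" for x y
    using that by (simp only: path_image_linepath closed_segment_subset convex_convex_hull hull_inc)
  have "path_class ?S (oriented_path \<gamma>' b) = path_class ?S (T \<circ> linepath 0 \<i>)"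
    using edges by (intro path_class_cong[OF loops(3)]) simp
  also have "\<dots> = path_class ?S (T \<circ> (linepath 0 1 +++ linepath 1 \<i>))"
    using T(2) segment
    by (intro path_class_eqI homotopic_paths_image_convex[OF convex_convex_hull T(1)] subset_path_image_join)
      (auto simp: punctured_surface_def)
  also have "\<dots> = path_class ?S (oriented_path \<gamma> b +++ oriented_path \<gamma> a)"
    unfolding path_compose_join using edges
    by (intro path_class_cong[OF loops_at_join[OF loops(2,1)], symmetric] joinpaths_eq) simp_all
  finally show ?thesis
    using loops by (simp add: fundamental_group_mult)
qed

section \<open>Values of a representation along a graph\<close>

locale surface_representation = standard_surface g q + G: group G
  for g and q :: "complex \<Rightarrow> 's::t2_space" and G :: "('x, 'y) monoid_scheme" +
  fixes \<tau> :: "(real \<Rightarrow> 's) set \<Rightarrow> 'x"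
  assumes hom: "\<tau> \<in> hom (surface_group q) G"
begin

sublocale rep: group_hom "surface_group q" G \<tau>
  by unfold_locales (rule hom)

lemma oriented_value_graph_values:
  assumes "embedded_graph g q \<gamma>" "fst a \<in> edges g"
  shows "oriented_value G (graph_values g q \<tau> \<gamma>) a = \<tau> (path_class (surface q) (oriented_path \<gamma> a))"
proof -
  note loop = embedded_graph_in_loops[OF assms]
  show ?thesis
    using assms(2) rep.hom_inv[OF path_class_in_carrier[OF loop]]
    by (simp add: oriented_value_def graph_values_def oriented_path_def fundamental_group_inv[OF loop])
qed

text \<open>If \<open>b\<close> carries the reversed orientation, the inversion in
  \<open>set_value\<close> undoes the reversal in \<open>oriented_path\<close>.\<close>

lemma set_value_graph_values:
  assumes "embedded_graph g q \<gamma>'" "fst b \<in> edges g" "\<forall>e\<in>edges g - {fst b}. \<gamma>' e = \<gamma> e"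
  shows "set_value G (graph_values g q \<tau> \<gamma>) b (\<tau> (path_class (surface q) (oriented_path \<gamma>' b)))
    = graph_values g q \<tau> \<gamma>'"
proof -
  note loop = embedded_graph_in_loops[OF assms(1,2)]
  have "(if snd b then y else inv\<^bsub>G\<^esub> y) = \<tau> (path_class (surface q) (\<gamma>' (fst b)))"
    if "y = \<tau> (path_class (surface q) (oriented_path \<gamma>' b))" for y
    using that rep.hom_inv[OF path_class_in_carrier[OF loop]] rep.hom_closed[OF path_class_in_carrier[OF loop]]
    by (simp add: oriented_path_def fundamental_group_inv[OF loop, symmetric])
  then show ?thesis
    using assms(2,3) by (auto simp: set_value_def graph_values_def)
qed

lemma slide_map_graph_values:
  assumes "slide_move g q s X Y"
  shows "slide_map G s (graph_values g q \<tau> (snd X)) = graph_values g q \<tau> (snd Y)"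
proof (cases s)
  case (Slide a b)
  then have slide: "graph_slide g q a b (snd X) (snd Y)" and ab: "fst a \<in> edges g" "fst b \<in> edges g"
    using assms by (auto simp: basic_move_def)
  then have emb: "embedded_graph g q (snd X)" "embedded_graph g q (snd Y)"
      "\<forall>e\<in>edges g - {fst b}. snd Y e = snd X e"
    by (auto simp: graph_slide_def)
  show ?thesis
    using set_value_graph_values[OF emb(2) ab(2) emb(3)] Slide
    by (simp add: oriented_value_graph_values emb ab graph_slide_path_class[OF slide ab]
        path_class_in_carrier oriented_path_in_loops[OF emb(1)])
next
  case (Inverse_Slide a b)
  then have slide: "graph_slide g q a b (snd Y) (snd X)" and ab: "fst a \<in> edges g" "fst b \<in> edges g"
      and neq: "fst a \<noteq> fst b"
    using assms by (auto simp: basic_move_def)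
  then have emb: "embedded_graph g q (snd X)" "embedded_graph g q (snd Y)"
      "\<forall>e\<in>edges g - {fst b}. snd Y e = snd X e"
    by (auto simp: graph_slide_def)
  \<comment> \<open>Here the slide leads from \<open>Y\<close> to \<open>X\<close>, so the class of
    \<open>b\<close> in \<open>X\<close> is that of \<open>a\<close> times that of \<open>b\<close>
    in \<open>Y\<close>. The edge of \<open>a\<close> is untouched, and its value cancels from the
    left.\<close>
  have "oriented_path (snd X) a = oriented_path (snd Y) a"
    using emb(3) ab neq by (simp add: oriented_path_def)
  moreover have "inv\<^bsub>G\<^esub> (\<tau> x) \<otimes>\<^bsub>G\<^esub> (\<tau> x \<otimes>\<^bsub>G\<^esub> \<tau> y) = \<tau> y"
    if "x \<in> carrier (surface_group q)" "y \<in> carrier (surface_group q)" for x y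
    using that by (simp add: G.m_assoc[symmetric])
  ultimately show ?thesis
    using set_value_graph_values[OF emb(2) ab(2) emb(3)] Inverse_Slide
    by (simp add: oriented_value_graph_values emb ab graph_slide_path_class[OF slide ab]
        path_class_in_carrier oriented_path_in_loops[OF emb(2)])
qed

lemma slide_sequence_graph_values:
  "slide_sequence g q ss X Y
    \<Longrightarrow> fold (slide_map G) ss (graph_values g q \<tau> (snd X)) = graph_values g q \<tau> (snd Y)"
proof (induction ss arbitrary: X)
  case (Cons s ss)
  then obtain Z where "slide_move g q s X Z" "slide_sequence g q ss Z Y" by auto
  then show ?case using Cons.IH[of Z] slide_map_graph_values[of s X Z] by simp
qed simp

text \<open>The homomorphism carries the surface relation to the values; this places the tuple of a
  representation in the coinvariants.\<close>

lemma relator_graph_values: "relator G g (graph_values g q \<tau> (standard_edge g q)) = \<one>\<^bsub>G\<^esub>"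
proof -
  have "relator G g (graph_values g q \<tau> (standard_edge g q)) = relator G g (\<lambda>e. \<tau> (generator g q e))"
    by (rule relator_cong) (simp add: graph_values_def generator_def)
  also have "\<dots> = \<tau> (relator (surface_group q) g (generator g q))"
    by (rule rep.hom_relator[symmetric]) (rule generator_in_carrier)
  finally show ?thesis
    by (simp add: relator_generator)
qed

end

section \<open>Mapping classes and representations\<close>

context standard_surface
begin

lemma edge_in_punctured_surface:
  assumes "e \<in> edges g" "t \<in> {0..1}"
  shows "standard_edge g q e t \<in> punctured_surface q"
  using assms by (cases e) (auto simp: punctured_surface_eq)

text \<open>The base path \<open>p\<close> ends at \<open>h v\<close> = \<open>n v\<close>, where
  the track \<open>d\<close> of the vertex under the homotopy begins. Together they form a loop
  \<open>l\<close> that does not depend on \<open>c\<close>, and the automorphism sends the image of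
  \<open>c\<close> under \<open>F\<close> to the class of \<open>l\<close>, \<open>c\<close>,
  reversed \<open>l\<close> in this order.\<close>

lemma represents_conj:
  assumes \<psi>: "represents q \<psi> \<phi>" and F: "continuous_on (surface q) F" "F ` surface q \<subseteq> surface q"
    and Fv: "F (vertex q) = vertex q"
    and \<phi>: "\<And>h. h \<in> \<phi> \<Longrightarrow> \<exists>n. homotopic_with_canon (\<lambda>_. True) (surface q) (surface q) n id \<and>
      (\<forall>x\<in>surface q. h (F x) = n x)"
  obtains k where "k \<in> carrier (surface_group q)"
    "\<And>c. c \<in> loops_at (surface q) (vertex q) \<Longrightarrow> \<psi> (path_class (surface q) (F \<circ> c))
      = k \<otimes>\<^bsub>surface_group q\<^esub> path_class (surface q) c \<otimes>\<^bsub>surface_group q\<^esub> inv\<^bsub>surface_group q\<^esub> k"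
proof -
  let ?S = "surface q" and ?v = "vertex q" and ?G = "surface_group q"
  obtain h p where h: "h \<in> \<phi>" and p: "path p" "path_image p \<subseteq> ?S" "pathstart p = ?v" "pathfinish p = h ?v"
    and eq: "\<forall>c\<in>loops_at ?S ?v. \<psi> (path_class ?S c) = path_class ?S (p +++ (h \<circ> c) +++ reversepath p)"
    using \<psi> unfolding represents_def by blast
  obtain n where n: "homotopic_with_canon (\<lambda>_. True) ?S ?S n id" "\<And>x. x \<in> ?S \<Longrightarrow> h (F x) = n x"
    using \<phi>[OF h] by blast
  obtain d where d: "path d" "path_image d \<subseteq> ?S" "pathstart d = n ?v" "pathfinish d = ?v"
    and hom: "\<And>c. c \<in> loops_at ?S ?v \<Longrightarrow> homotopic_paths ?S (n \<circ> c) (d +++ c +++ reversepath d)"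
    using homotopic_id_conjugates[OF n(1) vertex_in_surface] by metis
  have pd: "pathfinish p = pathstart d"
    using n(2)[OF vertex_in_surface] p(4) d(3) Fv by simp
  define l where "l = p +++ d"
  have l: "l \<in> loops_at ?S ?v"
    using p d pd by (simp add: l_def loops_at_def subset_path_image_join)
  \<comment> \<open>Going along \<open>l\<close>, \<open>c\<close> and back is conjugation by the
    reversed loop, since products are read from right to left.\<close>
  let ?k = "path_class ?S (reversepath l)"
  have inv_k: "inv\<^bsub>?G\<^esub> ?k = path_class ?S l"
    using fundamental_group_inv[OF loops_at_reversepath[OF l]] by simp
  show ?thesis
  proof (rule that[of ?k])
    show "?k \<in> carrier ?G" by (rule path_class_in_carrier[OF loops_at_reversepath[OF l]])
    fix c assume c: "c \<in> loops_at ?S ?v"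
    then have c': "path c" "path_image c \<subseteq> ?S" "pathstart c = ?v" "pathfinish c = ?v"
      by (auto simp: loops_at_def)
    have "path (F \<circ> c)"
      by (rule path_continuous_image[OF c'(1) continuous_on_subset[OF F(1) c'(2)]])
    then have Fc: "F \<circ> c \<in> loops_at ?S ?v"
      using c' F(2) Fv by (auto simp: loops_at_def path_image_compose pathstart_compose pathfinish_compose)
    have n_c: "path (n \<circ> c)" "path_image (n \<circ> c) \<subseteq> ?S"
      using homotopic_paths_imp_path[OF hom[OF c]] homotopic_paths_imp_subset[OF hom[OF c]] by blast+
    have n_c': "pathstart (n \<circ> c) = n ?v" "pathfinish (n \<circ> c) = n ?v"
      by (simp_all add: pathstart_compose pathfinish_compose c')
    have "h (F (c t)) = n (c t)" if "t \<in> {0..1}" for t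
      using n(2) c'(2) that by (simp add: path_image_def image_subset_iff)
    then have "homotopic_paths ?S (n \<circ> c) (h \<circ> (F \<circ> c))"
      by (intro homotopic_paths_eq n_c) simp
    then have "homotopic_paths ?S (h \<circ> (F \<circ> c)) (d +++ c +++ reversepath d)"
      using hom[OF c] homotopic_paths_sym homotopic_paths_trans by blast
    then have "homotopic_paths ?S ((h \<circ> (F \<circ> c)) +++ reversepath p) ((d +++ c +++ reversepath d) +++ reversepath p)"
      using p pd by (intro homotopic_paths_join) (auto simp: pathfinish_compose c' Fv)
    also have "homotopic_paths ?S ((d +++ c +++ reversepath d) +++ reversepath p) (d +++ (c +++ reversepath d) +++ reversepath p)"
      using p d pd c' by (intro homotopic_paths_sym[OF homotopic_paths_assoc]) (auto simp: path_image_join)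
    also have "homotopic_paths ?S (d +++ (c +++ reversepath d) +++ reversepath p) (d +++ c +++ reversepath d +++ reversepath p)"
      using p d pd c' by (intro homotopic_paths_join homotopic_paths_sym[OF homotopic_paths_assoc])
        (auto simp: path_image_join)
    finally have "homotopic_paths ?S ((h \<circ> (F \<circ> c)) +++ reversepath p) (d +++ c +++ reversepath l)"
      unfolding l_def reversepath_joinpaths[OF pd] .
    then have "homotopic_paths ?S (p +++ (h \<circ> (F \<circ> c)) +++ reversepath p) (p +++ d +++ c +++ reversepath l)"
      by (rule homotopic_paths_join[rotated]) (use p in \<open>simp_all add: pathstart_compose c' Fv\<close>)
    also have "homotopic_paths ?S (p +++ d +++ c +++ reversepath l) (l +++ c +++ reversepath l)"
      unfolding l_def using p d pd c' l unfolding l_def loops_at_def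
      by (intro homotopic_paths_assoc) (auto simp: path_image_join)
    finally have "\<psi> (path_class ?S (F \<circ> c)) = path_class ?S (l +++ c +++ reversepath l)"
      using eq Fc path_class_eqI by metis
    then show "\<psi> (path_class ?S (F \<circ> c)) = ?k \<otimes>\<^bsub>?G\<^esub> path_class ?S c \<otimes>\<^bsub>?G\<^esub> inv\<^bsub>?G\<^esub> ?k"
      unfolding inv_k using l c
      by (simp add: fundamental_group_mult loops_at_join loops_at_reversepath pi1.m_assoc path_class_in_carrier)
  qed
qed

end

context surface_representation
begin

text \<open>The automorphism \<psi> is, up to conjugation by \<open>k\<close>, inverse to the map
  induced by \<open>F\<close>, so precomposing with the inverse of \<psi> amounts to precomposing
  with \<open>F\<close>, up to a conjugation.\<close>

lemma mcg_act_rep_conj: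
  assumes \<sigma>: "\<sigma> \<in> mcg_act_rep q G \<phi> (conj_class (surface_group q) G \<tau>)"
    and F: "continuous_on (surface q) F" "F ` surface q \<subseteq> surface q" "F (vertex q) = vertex q"
    and \<phi>: "\<And>h. h \<in> \<phi> \<Longrightarrow> \<exists>n. homotopic_with_canon (\<lambda>_. True) (surface q) (surface q) n id \<and>
      (\<forall>x\<in>surface q. h (F x) = n x)"
  obtains u where "u \<in> carrier G"
    "\<And>c. c \<in> loops_at (surface q) (vertex q) \<Longrightarrow> \<sigma> (path_class (surface q) c)
      = u \<otimes>\<^bsub>G\<^esub> \<tau> (path_class (surface q) (F \<circ> c)) \<otimes>\<^bsub>G\<^esub> inv\<^bsub>G\<^esub> u"
proof -
  let ?S = "surface q" and ?v = "vertex q" and ?P = "surface_group q"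
  obtain \<tau>' \<psi> where \<tau>': "\<tau>' \<in> conj_class ?P G \<tau>" and \<psi>: "represents q \<psi> \<phi>"
    and \<sigma>': "\<sigma> \<in> conj_class ?P G (\<tau>' \<circ> inv_into (carrier ?P) \<psi>)"
    using \<sigma> unfolding mcg_act_rep_def by blast
  obtain u1 where u1: "u1 \<in> carrier G" "\<And>x. x \<in> carrier ?P \<Longrightarrow> \<tau>' x = u1 \<otimes>\<^bsub>G\<^esub> \<tau> x \<otimes>\<^bsub>G\<^esub> inv\<^bsub>G\<^esub> u1"
    using \<tau>' by (auto simp: conj_class_def)
  obtain u0 where u0: "u0 \<in> carrier G"
      "\<And>x. x \<in> carrier ?P \<Longrightarrow> \<sigma> x = u0 \<otimes>\<^bsub>G\<^esub> \<tau>' (inv_into (carrier ?P) \<psi> x) \<otimes>\<^bsub>G\<^esub> inv\<^bsub>G\<^esub> u0"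
    using \<sigma>' by (auto simp: conj_class_def)
  obtain k where k: "k \<in> carrier ?P"
    "\<And>c. c \<in> loops_at ?S ?v \<Longrightarrow>
      \<psi> (path_class ?S (F \<circ> c)) = k \<otimes>\<^bsub>?P\<^esub> path_class ?S c \<otimes>\<^bsub>?P\<^esub> inv\<^bsub>?P\<^esub> k"
    using represents_conj[OF \<psi> F \<phi>] by metis
  have iso: "\<psi> \<in> hom ?P ?P" "bij_betw \<psi> (carrier ?P) (carrier ?P)"
    using \<psi> by (auto simp: represents_def iso_def)
  interpret \<psi>: group_hom ?P ?P \<psi> by unfold_locales (rule iso(1))
  \<comment> \<open>Pulling \<open>k\<close> back along \<psi> expresses the inverse of \<psi> at
    the class of \<open>c\<close> as the class of \<open>F \<circ> c\<close> conjugated by the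
    inverse of \<open>k'\<close>.\<close>
  define k' where "k' = inv_into (carrier ?P) \<psi> k"
  have k': "k' \<in> carrier ?P" "\<psi> k' = k"
    using k(1) iso(2) by (auto simp: k'_def bij_betw_def inv_into_into f_inv_into_f)
  \<comment> \<open>The factors undo, from left to right, the choice of \<sigma>, the choice of
    \<tau>' and the conjugation by \<open>k'\<close>.\<close>
  define u where "u = u0 \<otimes>\<^bsub>G\<^esub> u1 \<otimes>\<^bsub>G\<^esub> inv\<^bsub>G\<^esub> (\<tau> k')"
  show ?thesis
  proof (rule that[of u])
    show "u \<in> carrier G" using u0(1) u1(1) k'(1) by (simp add: u_def)
    fix c assume c: "c \<in> loops_at ?S ?v"
    let ?x = "path_class ?S c" and ?y = "path_class ?S (F \<circ> c)"
    have "path (F \<circ> c)"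
      using c by (intro path_continuous_image continuous_on_subset[OF F(1)]) (auto simp: loops_at_def)
    then have "F \<circ> c \<in> loops_at ?S ?v"
      using c F by (auto simp: loops_at_def path_image_compose pathstart_compose pathfinish_compose)
    then have xy: "?x \<in> carrier ?P" "?y \<in> carrier ?P"
      using c by (simp_all add: path_class_in_carrier)
    have "\<psi> (inv\<^bsub>?P\<^esub> k' \<otimes>\<^bsub>?P\<^esub> ?y \<otimes>\<^bsub>?P\<^esub> k') = inv\<^bsub>?P\<^esub> k \<otimes>\<^bsub>?P\<^esub> (k \<otimes>\<^bsub>?P\<^esub> ?x \<otimes>\<^bsub>?P\<^esub> inv\<^bsub>?P\<^esub> k) \<otimes>\<^bsub>?P\<^esub> k"
      using k' xy k(2)[OF c] by simp
    also have "\<dots> = (inv\<^bsub>?P\<^esub> k \<otimes>\<^bsub>?P\<^esub> k) \<otimes>\<^bsub>?P\<^esub> ?x \<otimes>\<^bsub>?P\<^esub> (inv\<^bsub>?P\<^esub> k \<otimes>\<^bsub>?P\<^esub> k)"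
      using k(1) xy by (simp only: pi1.m_assoc pi1.m_closed pi1.inv_closed)
    also have "\<dots> = ?x" using k(1) xy by simp
    finally have "inv_into (carrier ?P) \<psi> ?x = inv\<^bsub>?P\<^esub> k' \<otimes>\<^bsub>?P\<^esub> ?y \<otimes>\<^bsub>?P\<^esub> k'"
      using iso(2) k' xy by (intro inv_into_f_eq) (auto simp: bij_betw_def)
    then show "\<sigma> ?x = u \<otimes>\<^bsub>G\<^esub> \<tau> ?y \<otimes>\<^bsub>G\<^esub> inv\<^bsub>G\<^esub> u"
      using xy k'(1) u0 u1 by (simp add: u_def G.inv_mult_group G.m_assoc)
  qed
qed

end

theorem corollary8p3:
  fixes H :: "('b, 'a) crossed_data" and g :: nat and q :: "complex \<Rightarrow> 's::t2_space"
  assumes "crossed_module H"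
    and "g \<ge> 1"
    and "closed_surface g q"
    and "edge_slide_action H g q \<Phi>"
  shows "\<forall>\<phi>\<in>carrier (mapping_class_group q).
           \<forall>\<tau>\<in>hom (surface_group q) (semidirect H).
             \<forall>\<sigma>\<in>mcg_act_rep q (semidirect H) \<phi> (conj_class (surface_group q) (semidirect H) \<tau>).
               snd (\<Phi> \<phi>) (represented_arrow H g q \<tau>) = represented_arrow H g q \<sigma>"
proof (intro ballI)
  fix \<phi> \<tau> \<sigma>
  assume \<phi>: "\<phi> \<in> carrier (mapping_class_group q)" and \<tau>: "\<tau> \<in> hom (surface_group q) (semidirect H)"
    and \<sigma>: "\<sigma> \<in> mcg_act_rep q (semidirect H) \<phi> (conj_class (surface_group q) (semidirect H) \<tau>)"
  let ?G = "semidirect H"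
  interpret standard_surface g q using assms(2,3) by unfold_locales
  interpret G: group ?G by (rule group_semidirect[OF assms(1)])
  interpret surface_representation g q ?G \<tau> by unfold_locales (rule \<tau>)
  obtain \<phi>' ss where \<phi>': "cap_off q \<phi>' = \<phi>" and ss: "realises g q ss \<phi>'"
    and ind: "induced_automorphism H g ss (\<Phi> \<phi>)"
    using assms(4) \<phi> unfolding edge_slide_action_def by blast
  obtain \<gamma> f where seq: "slide_sequence g q ss (standard_order g, standard_edge g q) (standard_order g, \<gamma>)"
    and f: "f \<in> carrier punctured_group" and cilium: "\<forall>t\<in>{0..1}. f (cilium q t) = cilium q t"
    and \<gamma>: "\<forall>e\<in>edges g. \<forall>t\<in>{0..1}. f (standard_edge g q e t) = \<gamma> e t"
    and \<phi>'_eq: "\<phi>' = inv\<^bsub>punctured_mapping_class_group q\<^esub>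
      (null_homotopic_punctured_homeos q #>\<^bsub>punctured_homeos q\<^esub> f)"
    using ss unfolding realises_def punctured_homeos_eq by blast
  define F where "F = extend_by_id q f"
  have F: "F x = f x" if "x \<in> punctured_surface q" for x
    using that by (simp add: F_def extend_by_id_apply punctured_surface_def)
  have "vertex q \<in> punctured_surface q"
    unfolding vertex_def punctured_surface_eq by (rule imageI) simp
  then have "F (vertex q) = f (vertex q)" by (rule F)
  also have "\<dots> = vertex q"
    \<comment> \<open>The cilium starts at the vertex, so a map fixing it pointwise fixes the base
      point.\<close>
    using bspec[OF cilium, of 0] by (simp add: cilium_def vertex_def)
  finally have vertex: "F (vertex q) = vertex q" .
  have "\<exists>n. homotopic_with_canon (\<lambda>_. True) (surface q) (surface q) n id \<and> (\<forall>x\<in>surface q. h (F x) = n x)"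
    if "h \<in> \<phi>" for h
    using cap_off_inv_coset[OF f, of h] that \<phi>' \<phi>'_eq unfolding F_def by metis
  then obtain u where u: "u \<in> carrier ?G"
    and conj: "\<And>c. c \<in> loops_at (surface q) (vertex q) \<Longrightarrow> \<sigma> (path_class (surface q) c)
      = u \<otimes>\<^bsub>?G\<^esub> \<tau> (path_class (surface q) (F \<circ> c)) \<otimes>\<^bsub>?G\<^esub> inv\<^bsub>?G\<^esub> u"
    using mcg_act_rep_conj[OF \<sigma> continuous_on_extend_by_id[OF f]] extend_by_id_closed[OF f] vertex
    unfolding F_def by (metis image_subsetI)
  have F_edge: "path_class (surface q) (F \<circ> standard_edge g q e) = path_class (surface q) (\<gamma> e)"
    and F_edge_carrier: "path_class (surface q) (F \<circ> standard_edge g q e) \<in> carrier (surface_group q)"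
    if e: "e \<in> edges g" for e
  proof -
    have "path (F \<circ> standard_edge g q e)"
      using standard_edge_in_loops[OF e] continuous_on_extend_by_id[OF f]
      unfolding F_def by (intro path_continuous_image) (auto simp: loops_at_def elim: continuous_on_subset)
    then have loop: "F \<circ> standard_edge g q e \<in> loops_at (surface q) (vertex q)"
      using standard_edge_in_loops[OF e] vertex extend_by_id_closed[OF f]
      by (auto simp: loops_at_def path_image_compose pathstart_compose pathfinish_compose F_def)
    then show "path_class (surface q) (F \<circ> standard_edge g q e) \<in> carrier (surface_group q)"
      by (rule path_class_in_carrier)
    show "path_class (surface q) (F \<circ> standard_edge g q e) = path_class (surface q) (\<gamma> e)"
      using \<gamma> e F edge_in_punctured_surface[OF e] by (intro path_class_cong[OF loop]) simp
  qed
  let ?m = "graph_values g q \<tau> (standard_edge g q)" and ?m' = "graph_values g q \<tau> \<gamma>"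
  have m: "?m \<in> edges g \<rightarrow>\<^sub>E carrier ?G"
    using rep.hom_closed generator_in_carrier by (auto simp: graph_values_def generator_def)
  have m': "?m' \<in> edges g \<rightarrow>\<^sub>E carrier ?G"
    using rep.hom_closed[OF F_edge_carrier] by (auto simp: graph_values_def F_edge)
  \<comment> \<open>The characterisation of the induced automorphism speaks of arrows of the
    coinvariants, so the relator must vanish on this tuple.\<close>
  have "?m \<in> Arr (coinvariants H g)"
    using m relator_graph_values
    by (simp add: coinvariants_def cat_equaliser_def tuple_cat_def cat_power_def cm_cat_def semidirect_def)
  then have "snd (\<Phi> \<phi>) (snd (invariants_functor H g) ?m) = snd (invariants_functor H g) (fold (slide_map ?G) ss ?m)"
    using ind by (simp add: induced_automorphism_def slides_functor_def)
  also have "fold (slide_map ?G) ss ?m = ?m'"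
    using slide_sequence_graph_values[OF seq] by simp
  also have "snd (invariants_functor H g) ?m' = snd (invariants_functor H g) (conj_tuple ?G g (u, ?m'))"
    by (rule invariants_functor_conj[OF assms(1) u m', symmetric])
  \<comment> \<open>The same \<open>u\<close> works for every edge, so the conjugated tuple is that
    of \<sigma>.\<close>
  also have "conj_tuple ?G g (u, ?m') = (\<lambda>e\<in>edges g. \<sigma> (generator g q e))"
    using conj[OF standard_edge_in_loops]
    by (auto simp: conj_tuple_def graph_values_def generator_def F_edge intro!: restrict_ext)
  finally show "snd (\<Phi> \<phi>) (represented_arrow H g q \<tau>) = represented_arrow H g q \<sigma>"
    by (simp only: represented_arrow_def graph_values_def generator_def)
qed

end
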